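(* Let $n\geq 1$. A generic differential operator of type DN (with $N=n$) is irreducible: there is a non-empty Zariski open subset $U$ of the affine space $\mathbb{A}$ of parameters of operators of type DN such that for every $A\in U(\mathbb{C})$ the operator $L_{A,\infty}$ is irreducible.
   Context: $\mathbb{A}$ is the affine space of complex matrices $A=(a_{ij})_{0\leq i,j\leq n}$ with $a_{ij}=0$ if $i-j>1$, $a_{ij}=1$ if $i-j=1$, and $a_{ij}=a_{n-j,n-i}$ for all $i,j$ (coordinates: the entries $a_{ij}$ with $i\leq j$, subject to the symmetry). The right determinant of a square matrix $M=(M_{ij})_{0\leq i,j\leq n}$ over an associative unital ring is $\det_{\mathrm{right}}(M)=\sum_\sigma \mathrm{sign}(\sigma)M_{\sigma(n),n}\cdots M_{\sigma(0),0}$, the sum over all permutations $\sigma$ of $\{0,\ldots,n\}$. For $A\in\mathbb{A}$ let $\tilde A$ be the matrix with $(i,j)$-entry $a_{ij}\partial_t^{\,j-i+1}$ (and $0$ if $i>j+1$), $\partial_t=d/dt$. The operator $\det_{\mathrm{right}}(t\partial_t-\tilde A)$ (with $t\partial_t$ times the identity matrix) is uniquely divisible on the right by $\partial_t$, and $L_{A,\infty}:=\det_{\mathrm{right}}(t\partial_t-\tilde A)\partial_t^{-1}$ is the quotient, an operator of order $n$. These $L_{A,\infty}$, $A\in\mathbb{A}$, are the operators of type DN. A differential operator $L\in\mathbb{C}(t)[\partial_t]$ is irreducible if it cannot be written as $L=L_1L_2$ with $L_1,L_2\in\mathbb{C}(t)[\partial_t]$ of positive order. *)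

theory Defs
  imports
    "HOL-Computational_Algebra.Computational_Algebra"
    "HOL-Combinatorics.Permutations"
    "Jordan_Normal_Form.Matrix"
begin

hide_const (open) Module.smult

section \<open>The differential field \<open>\<complex>(t)\<close>\<close>

type_synonym ratfun = "complex poly fract"

definition rderiv :: "ratfun \<Rightarrow> ratfun" where
  "rderiv f = (THE g. \<exists>p q. q \<noteq> 0 \<and> f = Fract p q \<and>
     g = Fract (pderiv p * q - p * pderiv q) (q * q))"

lemma rderiv_Fract:
  assumes b: "b \<noteq> 0"
  shows "rderiv (Fract a b) = Fract (pderiv a * b - a * pderiv b) (b * b)"
proof -
  have "Fract (pderiv a * b - a * pderiv b) (b * b) = Fract (pderiv c * d - c * pderiv d) (d * d)"
    if d: "d \<noteq> 0" and cd: "Fract a b = Fract c d" for c d :: "complex poly"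
  proof -
    have eq: "a * d = c * b" using b d cd by (simp add: eq_fract)
    have "pderiv (a * d) = pderiv (c * b)" using eq by simp
    then have e: "a * pderiv d + d * pderiv a = c * pderiv b + b * pderiv c"
      by (simp add: pderiv_mult)
    have "(pderiv a * b - a * pderiv b) * (d * d) - (pderiv c * d - c * pderiv d) * (b * b)
        = b * d * ((a * pderiv d + d * pderiv a) - (c * pderiv b + b * pderiv c))
          - (a * d - c * b) * (d * pderiv b + b * pderiv d)"
      by (simp add: algebra_simps)
    also have "\<dots> = 0" using e eq by simp
    finally show ?thesis using b d by (simp add: eq_fract)
  qed
  then show ?thesis
    unfolding rderiv_def using b by (intro the_equality) metis+
qed

lemma rderiv_add: "rderiv (f + g) = rderiv f + rderiv g"
proof (cases f; cases g)
  fix a b c d :: "complex poly"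
  assume f: "f = Fract a b" "b \<noteq> 0" and g: "g = Fract c d" "d \<noteq> 0"
  have "rderiv (f + g)
      = Fract (pderiv (a * d + c * b) * (b * d) - (a * d + c * b) * pderiv (b * d)) (b * d * (b * d))"
    using f g by (simp add: rderiv_Fract)
  moreover have "rderiv f + rderiv g
      = Fract ((pderiv a * b - a * pderiv b) * (d * d) + (pderiv c * d - c * pderiv d) * (b * b))
          (b * b * (d * d))"
    using f g by (simp add: rderiv_Fract)
  moreover have "pderiv (a * d + c * b) * (b * d) - (a * d + c * b) * pderiv (b * d)
      = (pderiv a * b - a * pderiv b) * (d * d) + (pderiv c * d - c * pderiv d) * (b * b)"
    by (simp add: pderiv_add pderiv_mult algebra_simps)
  ultimately show ?thesis by (simp add: mult_ac)
qed

lemma rderiv_mult: "rderiv (f * g) = rderiv f * g + f * rderiv g"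
proof (cases f; cases g)
  fix a b c d :: "complex poly"
  assume f: "f = Fract a b" "b \<noteq> 0" and g: "g = Fract c d" "d \<noteq> 0"
  have "rderiv (f * g)
      = Fract (pderiv (a * c) * (b * d) - (a * c) * pderiv (b * d)) (b * d * (b * d))"
    using f g by (simp add: rderiv_Fract)
  moreover have "rderiv f * g + f * rderiv g
      = Fract ((pderiv a * b - a * pderiv b) * c * (b * (d * d))
          + a * (pderiv c * d - c * pderiv d) * (b * b * d)) (b * b * d * (b * (d * d)))"
    using f g by (simp add: rderiv_Fract)
  moreover have "(pderiv (a * c) * (b * d) - (a * c) * pderiv (b * d)) * (b * b * d * (b * (d * d)))
      = ((pderiv a * b - a * pderiv b) * c * (b * (d * d))
          + a * (pderiv c * d - c * pderiv d) * (b * b * d)) * (b * d * (b * d))"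
    by (simp add: pderiv_mult algebra_simps)
  ultimately show ?thesis using f(2) g(2) by (simp add: eq_fract)
qed

lemma rderiv_0 [simp]: "rderiv 0 = 0"
  by (simp add: Zero_fract_def rderiv_Fract eq_fract)

lemma rderiv_1 [simp]: "rderiv 1 = 0"
  by (simp add: One_fract_def Zero_fract_def rderiv_Fract eq_fract)

section \<open>The ring \<open>\<complex>(t)[\<partial>\<^sub>t]\<close>\<close>

text \<open>The operator \<open>\<Sum>\<^sub>i f\<^sub>i \<partial>\<^sub>t\<^sup>i\<close>, coefficients on the left, is stored as the polynomial with
  coefficients \<open>f\<^sub>i\<close>; only the multiplication differs from that of polynomials.\<close>

datatype diffop = DiffOp (op_poly: "ratfun poly")

text \<open>\<open>dleft p\<close> is the product \<open>\<partial>\<^sub>t p\<close>: move \<open>\<partial>\<^sub>t\<close> past each coefficient by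
  \<open>\<partial>\<^sub>t f = f \<partial>\<^sub>t + f'\<close>.\<close>

definition dleft :: "ratfun poly \<Rightarrow> ratfun poly" where
  "dleft p = pCons 0 p + map_poly rderiv p"

definition op_mult :: "ratfun poly \<Rightarrow> ratfun poly \<Rightarrow> ratfun poly" where
  "op_mult p q = (\<Sum>i\<le>degree p. smult (coeff p i) ((dleft ^^ i) q))"

lemma dleft_add: "dleft (p + q) = dleft p + dleft q"
  by (rule poly_eqI) (simp add: dleft_def coeff_map_poly rderiv_add coeff_pCons split: nat.splits)

lemma dleft_0 [simp]: "dleft 0 = 0"
  by (simp add: dleft_def)

lemma dleft_smult: "dleft (smult c p) = smult (rderiv c) p + smult c (dleft p)"
  by (rule poly_eqI)
    (simp add: dleft_def coeff_map_poly rderiv_mult coeff_pCons algebra_simps split: nat.splits)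

lemma dleft_sum: "dleft (sum f A) = (\<Sum>x\<in>A. dleft (f x))"
  by (induction A rule: infinite_finite_induct) (simp_all add: dleft_add)

lemma dleft_pow_add: "(dleft ^^ i) (p + q) = (dleft ^^ i) p + (dleft ^^ i) q"
  by (induction i) (simp_all add: dleft_add)

lemma op_mult_le:
  assumes "degree p \<le> N"
  shows "op_mult p q = (\<Sum>i\<le>N. smult (coeff p i) ((dleft ^^ i) q))"
  unfolding op_mult_def
  by (rule sum.mono_neutral_left) (use assms in \<open>auto simp: coeff_eq_0\<close>)

lemma op_mult_add_left: "op_mult (p + p') q = op_mult p q + op_mult p' q"
proof -
  define N where "N = max (degree p) (degree p')"
  have "degree (p + p') \<le> N" "degree p \<le> N" "degree p' \<le> N"
    using degree_add_le_max[of p p'] by (auto simp: N_def)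
  then show ?thesis
    by (simp add: op_mult_le[where N = N] smult_add_left sum.distrib)
qed

lemma op_mult_add_right: "op_mult p (q + q') = op_mult p q + op_mult p q'"
  by (simp add: op_mult_def dleft_pow_add smult_add_right sum.distrib)

lemma op_mult_0_left [simp]: "op_mult 0 q = 0"
  by (simp add: op_mult_def)

lemma op_mult_smult: "op_mult (smult c p) q = smult c (op_mult p q)"
proof -
  have sum: "smult c (sum f A) = (\<Sum>x\<in>A. smult c (f x))" for f :: "nat \<Rightarrow> ratfun poly" and A
    by (induction A rule: infinite_finite_induct) (simp_all add: smult_add_right)
  show ?thesis
    by (simp add: op_mult_le[OF degree_smult_le] op_mult_def[of p] sum)
qed

lemma op_mult_sum: "op_mult (sum f A) q = (\<Sum>x\<in>A. op_mult (f x) q)"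
  by (induction A rule: infinite_finite_induct) (simp_all add: op_mult_add_left)

lemma dleft_op_mult: "dleft (op_mult p q) = op_mult (dleft p) q"
proof -
  let ?N = "degree p"
  have 1: "op_mult (pCons 0 p) q = (\<Sum>i\<le>?N. smult (coeff p i) ((dleft ^^ Suc i) q))"
    by (subst op_mult_le[where N = "Suc ?N"]) (simp_all add: degree_pCons_le sum.atMost_Suc_shift del: sum.atMost_Suc)
  have 2: "op_mult (map_poly rderiv p) q = (\<Sum>i\<le>?N. smult (rderiv (coeff p i)) ((dleft ^^ i) q))"
    by (subst op_mult_le[where N = ?N]) (auto simp: coeff_map_poly coeff_eq_0 intro: degree_le)
  have "op_mult (dleft p) q = op_mult (pCons 0 p) q + op_mult (map_poly rderiv p) q"
    by (simp add: dleft_def op_mult_add_left)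
  also have "\<dots> = dleft (op_mult p q)"
    unfolding 1 2 by (simp add: op_mult_def dleft_sum dleft_smult sum.distrib)
  finally show ?thesis by simp
qed

lemma dleft_pow_op_mult: "(dleft ^^ i) (op_mult p q) = op_mult ((dleft ^^ i) p) q"
  by (induction i) (simp_all add: dleft_op_mult)

lemma op_mult_assoc: "op_mult (op_mult p q) r = op_mult p (op_mult q r)"
  by (simp add: op_mult_def[of p] op_mult_sum op_mult_smult dleft_pow_op_mult)

lemma dleft_pow_1: "(dleft ^^ i) 1 = monom 1 i"
proof (induction i)
  case (Suc i)
  have "map_poly rderiv (monom 1 i) = 0"
    by (rule poly_eqI) (simp add: coeff_map_poly)
  then show ?case using Suc by (simp add: dleft_def monom_Suc)
qed (simp add: monom_0 one_pCons)

lemma op_mult_1_right: "op_mult p 1 = p"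
  by (simp add: op_mult_def dleft_pow_1 smult_monom poly_as_sum_of_monoms)

lemma op_mult_1_left: "op_mult 1 p = p"
  by (simp add: op_mult_def)

instantiation diffop :: ring_1
begin

definition "0 = DiffOp 0"
definition "1 = DiffOp 1"
definition "L + M = DiffOp (op_poly L + op_poly M)"
definition "L - M = DiffOp (op_poly L - op_poly M)"
definition "- L = DiffOp (- op_poly L)"
definition "L * M = DiffOp (op_mult (op_poly L) (op_poly M))"

instance
  by standard
    (simp_all add: zero_diffop_def one_diffop_def plus_diffop_def minus_diffop_def
      uminus_diffop_def times_diffop_def op_mult_assoc op_mult_1_left op_mult_1_right
      op_mult_add_left op_mult_add_right add_ac)

end

definition op_order :: "diffop \<Rightarrow> nat" where
  "op_order L = degree (op_poly L)"

definition op_fun :: "ratfun \<Rightarrow> diffop" where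
  "op_fun f = DiffOp [:f:]"

definition op_const :: "complex \<Rightarrow> diffop" where
  "op_const c = op_fun (to_fract [:c:])"

definition op_t :: diffop where
  "op_t = op_fun (to_fract [:0, 1:])"

definition op_d :: diffop where
  "op_d = DiffOp (monom 1 1)"

lemma op_d_fun: "op_d * op_fun f = op_fun f * op_d + op_fun (rderiv f)"
  by (simp add: op_d_def op_fun_def times_diffop_def plus_diffop_def op_mult_def dleft_def
      degree_monom_eq map_poly_pCons monom_Suc monom_0)

lemma op_fun_mult: "op_fun f * op_fun g = op_fun (f * g)"
  by (simp add: op_fun_def times_diffop_def op_mult_def)

lemma op_d_t: "op_d * op_t = op_t * op_d + 1"
  by (simp add: op_t_def op_d_fun to_fract_def rderiv_Fract)
    (simp add: op_fun_def one_diffop_def pderiv_pCons One_fract_def[symmetric] one_pCons[symmetric])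

lemma op_poly_mult_d: "op_poly (L * op_d) = pCons 0 (op_poly L)"
proof -
  have 1: "(dleft ^^ i) (monom 1 1) = pCons 0 (monom 1 i)" for i
    using dleft_pow_1[of "Suc i"] dleft_pow_1[of 1]
    by (simp add: monom_Suc funpow_swap1)
  have "op_mult p (monom 1 1) = pCons 0 p" for p
  proof -
    have "op_mult p (monom 1 1) = (\<Sum>i\<le>degree p. pCons 0 (monom (coeff p i) i))"
      unfolding op_mult_def 1 by (simp add: smult_monom)
    also have "\<dots> = pCons 0 (\<Sum>i\<le>degree p. monom (coeff p i) i)"
      by (induction "degree p" rule: nat.induct)
        (simp_all add: poly_eq_iff coeff_pCons coeff_sum split: nat.splits)
    finally show ?thesis by (simp add: poly_as_sum_of_monoms)
  qed
  then show ?thesis by (simp add: times_diffop_def op_d_def)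
qed

lemma op_mult_d_cancel: "L * op_d = M * op_d \<Longrightarrow> L = M"
  using op_poly_mult_d[of L] op_poly_mult_d[of M] by (metis diffop.expand pCons_eq_iff)

definition op_irreducible :: "diffop \<Rightarrow> bool" where
  "op_irreducible L \<longleftrightarrow>
    \<not> (\<exists>L1 L2. L = L1 * L2 \<and> op_order L1 > 0 \<and> op_order L2 > 0)"

section \<open>Right determinants\<close>

text \<open>In each product the column index decreases from left to right.\<close>

definition det_right :: "'a::ring_1 mat \<Rightarrow> 'a" where
  "det_right M = (\<Sum>p | p permutes {..<dim_row M}.
     of_int (sign p) * prod_list (map (\<lambda>j. M $$ (p j, j)) (rev [0..<dim_row M])))"

section \<open>The parameter space and its Zariski topology\<close>

definition DN_params :: "nat \<Rightarrow> complex mat set" where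
  "DN_params n = {A \<in> carrier_mat (Suc n) (Suc n).
     (\<forall>i\<le>n. \<forall>j\<le>n.
        (i > j + 1 \<longrightarrow> A $$ (i, j) = 0) \<and>
        (i = j + 1 \<longrightarrow> A $$ (i, j) = 1) \<and>
        A $$ (i, j) = A $$ (n - j, n - i))}"

text \<open>The polynomial functions in the coordinates \<open>a\<^sub>i\<^sub>j\<close>, \<open>i \<le> j\<close>. Coordinates exchanged by the
  symmetry have the same restriction to \<open>DN_params n\<close>.\<close>

inductive_set DN_poly_funs :: "nat \<Rightarrow> (complex mat \<Rightarrow> complex) set" for n where
  const: "(\<lambda>A. c) \<in> DN_poly_funs n"
| coord: "i \<le> j \<Longrightarrow> j \<le> n \<Longrightarrow> (\<lambda>A. A $$ (i, j)) \<in> DN_poly_funs n"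
| add: "f \<in> DN_poly_funs n \<Longrightarrow> g \<in> DN_poly_funs n \<Longrightarrow> (\<lambda>A. f A + g A) \<in> DN_poly_funs n"
| mult: "f \<in> DN_poly_funs n \<Longrightarrow> g \<in> DN_poly_funs n \<Longrightarrow> (\<lambda>A. f A * g A) \<in> DN_poly_funs n"

definition DN_zariski_closed :: "nat \<Rightarrow> complex mat set \<Rightarrow> bool" where
  "DN_zariski_closed n Z \<longleftrightarrow>
    (\<exists>F \<subseteq> DN_poly_funs n. Z = {A \<in> DN_params n. \<forall>f\<in>F. f A = 0})"

definition DN_zariski_open :: "nat \<Rightarrow> complex mat set \<Rightarrow> bool" where
  "DN_zariski_open n U \<longleftrightarrow> U \<subseteq> DN_params n \<and> DN_zariski_closed n (DN_params n - U)"

section \<open>Operators of type DN\<close>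

definition DN_tilde :: "nat \<Rightarrow> complex mat \<Rightarrow> diffop mat" where
  "DN_tilde n A = mat (Suc n) (Suc n)
     (\<lambda>(i, j). if i > j + 1 then 0 else op_const (A $$ (i, j)) * op_d ^ (j + 1 - i))"

definition DN_det :: "nat \<Rightarrow> complex mat \<Rightarrow> diffop" where
  "DN_det n A = det_right ((op_t * op_d) \<cdot>\<^sub>m 1\<^sub>m (Suc n) - DN_tilde n A)"

lemma op_const_mult_d: "op_d * op_const c = op_const c * op_d"
  by (simp add: op_const_def op_d_fun to_fract_def rderiv_Fract pderiv_pCons)
    (simp add: op_fun_def zero_diffop_def Zero_fract_def[symmetric])

lemma op_const_mult: "op_const a * op_const b = op_const (a * b)"
  by (simp add: op_const_def op_fun_mult to_fract_def mult.commute)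

lemma op_const_1: "op_const 1 = 1"
  by (simp add: op_const_def op_fun_def one_diffop_def flip: one_pCons)

lemma op_const_0: "op_const 0 = 0"
  by (simp add: op_const_def op_fun_def zero_diffop_def)

lemma op_const_uminus: "op_const (- a) = - op_const a"
  by (simp add: op_const_def op_fun_def uminus_diffop_def to_fract_def)

lemma DN_det_divisible: "\<exists>!L. L * op_d = DN_det n A"
proof -
  define M where "M = (op_t * op_d) \<cdot>\<^sub>m 1\<^sub>m (Suc n) - DN_tilde n A"
  define R where "R = range (\<lambda>L. L * op_d)"
  have R0: "0 \<in> R" unfolding R_def by (rule range_eqI[of _ _ 0]) simp
  have Radd: "x + y \<in> R" if "x \<in> R" "y \<in> R" for x y
    using that unfolding R_def by (auto simp flip: distrib_right)
  have Rdiff: "x - y \<in> R" if "x \<in> R" "y \<in> R" for x y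
    using that unfolding R_def by (auto simp flip: left_diff_distrib)
  have Rneg: "- x \<in> R" if "x \<in> R" for x
    using that Rdiff[OF R0] by fastforce
  have Rleft: "x * y \<in> R" if "y \<in> R" for x y
    using that unfolding R_def by (auto simp flip: mult.assoc)
  have Rconst: "x * op_const c \<in> R" if "x \<in> R" for x c
  proof -
    from that obtain L where "x = L * op_d" unfolding R_def by auto
    then have "x * op_const c = (L * op_const c) * op_d"
      by (simp add: mult.assoc op_const_mult_d)
    then show ?thesis unfolding R_def by blast
  qed
  have d: "op_d \<in> R" unfolding R_def by (rule range_eqI[of _ _ 1]) simp
  have upper: "M $$ (i, j) \<in> R" if "i \<le> j" "j < Suc n" for i j
  proof -
    have "op_d ^ (j + 1 - i) = op_d ^ (j - i) * op_d"
      using that by (simp add: Suc_diff_le power_Suc2 del: power_Suc)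
    then have "op_const (A $$ (i, j)) * op_d ^ (j + 1 - i) \<in> R"
      using d by (simp add: Rleft)
    then show ?thesis
      using that d R0 by (auto simp: M_def DN_tilde_def intro!: Rdiff Rleft Rneg)
  qed
  have lower: "M $$ (i, j) \<in> range op_const" if "i > j" "i < Suc n" for i j
  proof -
    have "M $$ (i, j) = (if i = j + 1 then op_const (- A $$ (i, j)) else op_const 0)"
      using that by (auto simp: M_def DN_tilde_def op_const_uminus op_const_0)
    then show ?thesis by auto
  qed
  have prod: "prod_list (map (\<lambda>j. M $$ (p j, j)) (rev [0..<Suc n])) \<in> R"
    if p: "p permutes {..<Suc n}" for p
  proof -
    have pl: "p j < Suc n" if "j < Suc n" for j
      using permutes_in_image[OF p, of j] that by simp
    let ?P = "\<lambda>k. prod_list (map (\<lambda>j. M $$ (p j, j)) (rev [0..<k]))"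
    have "k \<le> Suc n \<Longrightarrow> ?P k \<in> R \<or> (?P k \<in> range op_const \<and> (\<forall>j<k. p j > j))" for k
    proof (induction k)
      case 0
      have "1 \<in> range op_const" using op_const_1 by (metis rangeI)
      then show ?case by simp
    next
      case (Suc k)
      have eq: "?P (Suc k) = M $$ (p k, k) * ?P k" by simp
      from Suc have "?P k \<in> R \<or> (?P k \<in> range op_const \<and> (\<forall>j<k. p j > j))" by simp
      then consider "?P k \<in> R" | c where "?P k = op_const c" "\<forall>j<k. p j > j" by blast
      then show ?case
      proof cases
        case 1
        then show ?thesis unfolding eq by (simp add: Rleft)
      next
        case 2
        show ?thesis
        proof (cases "p k > k")
          case True
          then obtain c' where "M $$ (p k, k) = op_const c'"
            using lower[OF True] pl Suc.prems by auto
          then show ?thesis unfolding eq using 2 True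
            by (auto simp: op_const_mult less_Suc_eq)
        next
          case False
          then have "M $$ (p k, k) \<in> R" using upper[of "p k" k] Suc.prems by simp
          then show ?thesis unfolding eq using 2 by (simp add: Rconst)
        qed
      qed
    qed
    from this[of "Suc n"] show ?thesis using pl[of n] by auto
  qed
  have dim: "dim_row M = Suc n" by (simp add: M_def DN_tilde_def)
  have sum_R: "(\<Sum>x\<in>X. f x) \<in> R" if "\<And>x. x \<in> X \<Longrightarrow> f x \<in> R" for f and X :: "(nat \<Rightarrow> nat) set"
    using that by (induction X rule: infinite_finite_induct) (auto simp: R0 Radd)
  have "DN_det n A \<in> R"
    unfolding DN_det_def M_def[symmetric] det_right_def dim
    by (rule sum_R) (use prod in \<open>blast intro: Rleft\<close>)
  then obtain L where "DN_det n A = L * op_d" unfolding R_def by auto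
  then show ?thesis by (metis op_mult_d_cancel)
qed

definition DN_op :: "nat \<Rightarrow> complex mat \<Rightarrow> diffop" where
  "DN_op n A = (THE L. L * op_d = DN_det n A)"

lemma DN_op_mult_d: "DN_op n A * op_d = DN_det n A"
  unfolding DN_op_def by (rule theI'[OF DN_det_divisible])

end

theory Submission
  imports Defs "Subresultants.Subresultant_Gcd" "HOL-Computational_Algebra.Field_as_Ring"
begin

hide_const (open) Module.smult

text \<open>The operator \<open>L = DN_op n A\<close> is irreducible as soon as the characteristic polynomial \<open>\<chi>\<close> of
\<open>A\<close> has only simple roots. The reason is Fuchs' relation between local exponents: the exponents
of \<open>L\<close> leave no room for a right factor of order strictly between \<open>0\<close> and \<open>n\<close>.

Write \<open>L = \<chi> \<partial>\<^sup>n + c \<partial>\<^sup>n\<^sup>-\<^sup>1 + \<dots>\<close>. A Hessenberg recursion for the right determinant shows that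
the antidiagonal symmetry of \<open>A\<close> forces \<open>c = (n/2) \<chi>'\<close>. Hence the exponents of \<open>L\<close> are
\<open>0, \<dots>, n - 2, (n - 2)/2\<close> at a root of \<open>\<chi>\<close> and \<open>0, \<dots>, n - 1\<close> at the other finite points. At infinity
the leading form of \<open>L\<close> sends \<open>t\<^sup>x\<close> to \<open>(x + 1)\<^sup>n t\<^sup>x\<^sup>+\<^sup>1\<close>, so all exponents coincide there.

Suppose that \<open>L = L\<^sub>1 L\<^sub>2\<close> with \<open>L\<^sub>2 = u \<partial>\<^sup>k + v \<partial>\<^sup>k\<^sup>-\<^sup>1 + \<dots>\<close> and \<open>0 < k < n\<close>. After clearing
denominators everything lives in the Weyl algebra. Leading forms, at a finite point or at
infinity, are multiplicative, so the indicial polynomial of \<open>L\<^sub>2\<close> divides that of \<open>L\<close>; comparing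
degrees shows that it has degree exactly \<open>k\<close> (lemma \<open>extremal_divides\<close>). The sum of its roots is
\<open>k(k - 1)/2 - r\<close>, where \<open>r\<close> is the residue of \<open>v/u\<close> at the point. Choosing \<open>k\<close> of the exponents of \<open>L\<close>
gives \<open>Re r \<le> max 0 (k - n/2)\<close> at each of the at most \<open>n + 1\<close> roots of \<open>\<chi>\<close>, and \<open>Re r \<le> 0\<close> elsewhere
(lemma \<open>residue_bound\<close>), whereas at infinity one reads off that the residues add up to \<open>k(k + 1)/2\<close>
(lemmas \<open>residue_sum_at_infinity\<close> and \<open>sum_of_residues\<close>). This is a contradiction, because
\<open>k(k + 1)/2 - (n + 1)(k - n/2) = (n - k)(n + 1 - k)/2 > 0\<close>.

Simplicity of the roots is the non-vanishing of the resultant of \<open>\<chi>\<close> and \<open>\<chi>'\<close>, a polynomial in the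
entries of \<open>A\<close>, and it holds for the matrix of a cyclic shift, where \<open>\<chi> = t\<^sup>n\<^sup>+\<^sup>1 - 1\<close>.\<close>

section \<open>Right determinants of Hessenberg matrices\<close>

text \<open>The determinant of the block with rows and columns \<open>l, \<dots>, l + d - 1\<close> of a Hessenberg matrix whose
subdiagonal entries are \<open>-1\<close> and whose entries on and above the diagonal are given by \<open>f\<close>, expanded
along the last column. The order of the factors matters: the recursion serves both for
operators and for the polynomials that are their leading coefficients.\<close>

fun hess :: "(nat \<Rightarrow> nat \<Rightarrow> 'a::ring_1) \<Rightarrow> nat \<Rightarrow> nat \<Rightarrow> 'a" where
  "hess f l 0 = 1"
| "hess f l (Suc d) = (\<Sum>i\<le>d. f (l + i) (l + d) * hess f l i)"

text \<open>The terms of \<open>det_right\<close>, with the matrix given by an entry function, so that all leading blocks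
share the same \<open>f\<close>.\<close>

definition col_prod :: "(nat \<Rightarrow> nat \<Rightarrow> 'a::ring_1) \<Rightarrow> nat \<Rightarrow> (nat \<Rightarrow> nat) \<Rightarrow> 'a" where
  "col_prod f k p = prod_list (map (\<lambda>j. f (p j) j) (rev [0..<k]))"

definition col_det :: "(nat \<Rightarrow> nat \<Rightarrow> 'a::ring_1) \<Rightarrow> nat \<Rightarrow> 'a" where
  "col_det f k = (\<Sum>p | p permutes {..<k}. of_int (sign p) * col_prod f k p)"

text \<open>The cofactor of the entry \<open>(i, k)\<close> in the expansion along column \<open>k\<close>, the leftmost factor of every
product.\<close>

definition last_minor :: "(nat \<Rightarrow> nat \<Rightarrow> 'a::ring_1) \<Rightarrow> nat \<Rightarrow> nat \<Rightarrow> 'a" where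
  "last_minor f k i =
     (\<Sum>p | p permutes {..<Suc k} \<and> p k = i. of_int (sign p) * col_prod f k p)"

lemma col_prod_Suc: "col_prod f (Suc k) p = f (p k) k * col_prod f k p"
  by (simp add: col_prod_def)

lemma col_prod_cong: "(\<And>j. j < k \<Longrightarrow> p j = q j) \<Longrightarrow> col_prod f k p = col_prod f k q"
  unfolding col_prod_def by (intro arg_cong[of _ _ prod_list] map_cong) auto

lemma col_prod_eq_0:
  assumes "j < k" "f (p j) j = 0"
  shows "col_prod f k p = 0"
  using assms
proof (induction k)
  case (Suc k)
  then show ?case by (cases "j = k") (auto simp: col_prod_Suc)
qed simp

lemma finite_perms: "finite {p. p permutes {..<k::nat} \<and> P p}"
  by (rule finite_subset[OF _ finite_permutations[of "{..<k}"]]) auto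

lemma of_int_sign_commute: "of_int (sign p) * (x * y) = x * (of_int (sign p) * (y :: 'a::ring_1))"
  by (simp add: sign_def)

lemma col_det_expand: "col_det f (Suc k) = (\<Sum>i\<le>k. f i k * last_minor f k i)"
proof -
  have "col_det f (Suc k) =
     (\<Sum>i\<le>k. \<Sum>p | p permutes {..<Suc k} \<and> p k = i. of_int (sign p) * col_prod f (Suc k) p)"
    unfolding col_det_def
  proof (subst sum.group[symmetric, where g = "\<lambda>p. p k" and T = "{..k}"])
    show "(\<lambda>p. p k) ` {p. p permutes {..<Suc k}} \<subseteq> {..k}"
      using permutes_in_image less_Suc_eq_le by fastforce
    show "finite {p. p permutes {..<Suc k}}" by (rule finite_permutations) simp
  qed (auto intro!: sum.cong)
  also have "\<dots> = (\<Sum>i\<le>k. f i k * last_minor f k i)"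
    unfolding last_minor_def sum_distrib_left
    by (intro sum.cong refl) (auto simp: col_prod_Suc of_int_sign_commute)
  finally show ?thesis .
qed

lemma last_minor_diag: "last_minor f k k = col_det f k"
proof -
  have "{p. p permutes {..<Suc k} \<and> p k = k} = {p. p permutes {..<k}}"
  proof (intro equalityI subsetI; clarify)
    fix p assume "p permutes {..<Suc k}" "p k = k"
    then show "p permutes {..<k}"
      by (elim permutes_superset) (auto simp: less_Suc_eq)
  next
    fix p assume p: "p permutes {..<k}"
    show "p permutes {..<Suc k} \<and> p k = k"
      using permutes_subset[OF p, of "{..<Suc k}"] permutes_not_in[OF p, of k] by auto
  qed
  then show ?thesis by (simp add: last_minor_def col_det_def)
qed

text \<open>Once row \<open>i\<close> is taken by the last column, row \<open>k + 1\<close> can only be covered by column \<open>k\<close>, with entry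
\<open>-1\<close>. Exchanging the values \<open>i\<close> and \<open>k + 1\<close> of the permutation removes this column, and the sign of
the transposition cancels the entry.\<close>

lemma last_minor_below:
  assumes hess: "\<And>i j. i > j + 1 \<Longrightarrow> f i j = 0" "\<And>j. f (j + 1) j = -1"
    and i: "i \<le> k"
  shows "last_minor f (Suc k) i = last_minor f k i"
proof -
  \<comment> \<open>The same composition maps the two sets of permutations onto each other in both directions.\<close>
  let ?t = "\<lambda>p. transpose (Suc k) i \<circ> p"
  have sub: "(\<Sum>p | p permutes {..<Suc (Suc k)} \<and> p (Suc k) = i. of_int (sign p) * col_prod f (Suc k) p)
      = (\<Sum>p | p permutes {..<Suc (Suc k)} \<and> p (Suc k) = i \<and> p k = Suc k.
          of_int (sign p) * col_prod f (Suc k) p)"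
  proof (rule sum.mono_neutral_right)
    show "finite {p. p permutes {..<Suc (Suc k)} \<and> p (Suc k) = i}" by (rule finite_perms)
    show "\<forall>p\<in>{p. p permutes {..<Suc (Suc k)} \<and> p (Suc k) = i} -
        {p. p permutes {..<Suc (Suc k)} \<and> p (Suc k) = i \<and> p k = Suc k}.
       of_int (sign p) * col_prod f (Suc k) p = 0"
    proof
      fix p assume "p \<in> {p. p permutes {..<Suc (Suc k)} \<and> p (Suc k) = i} -
        {p. p permutes {..<Suc (Suc k)} \<and> p (Suc k) = i \<and> p k = Suc k}"
      then have p: "p permutes {..<Suc (Suc k)}" and pi: "p (Suc k) = i" and nk: "p k \<noteq> Suc k"
        by auto
      obtain j where j: "p j = Suc k" using permutes_surj[OF p] by (metis surjD)
      have "j < Suc (Suc k)" using permutes_in_image[OF p, of j] j by simp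
      moreover have "j \<noteq> Suc k" using j pi i by auto
      moreover have "j \<noteq> k" using j nk by auto
      ultimately have "j < k" by simp
      then have "col_prod f (Suc k) p = 0"
        by (intro col_prod_eq_0[of j]) (use j hess in auto)
      then show "of_int (sign p) * col_prod f (Suc k) p = 0" by simp
    qed
  qed auto
  also have "\<dots> = (\<Sum>p | p permutes {..<Suc k} \<and> p k = i. of_int (sign p) * col_prod f k p)"
  proof (rule sum.reindex_bij_witness[where i = ?t and j = ?t])
    fix p assume "p \<in> {p. p permutes {..<Suc (Suc k)} \<and> p (Suc k) = i \<and> p k = Suc k}"
    then have p: "p permutes {..<Suc (Suc k)}" and pk: "p (Suc k) = i" "p k = Suc k" by auto
    show "?t (?t p) = p" by (simp add: fun_eq_iff)
    have tp: "?t p permutes {..<Suc (Suc k)}"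
      by (rule permutes_compose[OF p]) (use i in \<open>auto intro: permutes_swap_id\<close>)
    have "?t p permutes {..<Suc k}"
      by (rule permutes_superset[OF tp]) (use pk in \<open>auto simp: less_Suc_eq\<close>)
    then show "?t p \<in> {p. p permutes {..<Suc k} \<and> p k = i}" using pk by auto
    have "sign (?t p) = sign (transpose (Suc k) i) * sign p"
      by (rule sign_compose) (use p in \<open>auto intro: permutation_permutes[THEN iffD2] permutation_swap_id\<close>)
    also have "\<dots> = - sign p" using i by (simp add: sign_swap_id)
    finally have s: "sign (?t p) = - sign p" .
    have "?t p j = p j" if "j < k" for j
    proof -
      have "p j \<noteq> p (Suc k)" "p j \<noteq> p k"
        using that inj_eq[OF permutes_inj[OF p]] by simp_all
      then show ?thesis unfolding pk by (simp add: transpose_def)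
    qed
    then have "col_prod f k (?t p) = col_prod f k p" by (rule col_prod_cong)
    then show "of_int (sign (?t p)) * col_prod f k (?t p) = of_int (sign p) * col_prod f (Suc k) p"
      using hess(2)[of k] pk by (simp add: s col_prod_Suc)
  next
    fix p assume "p \<in> {p. p permutes {..<Suc k} \<and> p k = i}"
    then have p: "p permutes {..<Suc k}" and pk: "p k = i" by auto
    show "?t (?t p) = p" by (simp add: fun_eq_iff)
    have p': "p permutes {..<Suc (Suc k)}" by (rule permutes_subset[OF p]) auto
    have "p (Suc k) = Suc k" by (rule permutes_not_in[OF p]) simp
    moreover have "?t p permutes {..<Suc (Suc k)}"
      by (rule permutes_compose[OF p']) (use i in \<open>auto intro: permutes_swap_id\<close>)
    ultimately show "?t p \<in> {p. p permutes {..<Suc (Suc k)} \<and> p (Suc k) = i \<and> p k = Suc k}"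
      using pk i by auto
  qed
  finally show ?thesis unfolding last_minor_def .
qed

lemma col_det_eq_hess:
  assumes "\<And>i j. i > j + 1 \<Longrightarrow> f i j = 0" "\<And>j. f (j + 1) j = -1"
  shows "col_det f k = hess f 0 k"
proof (induction k rule: less_induct)
  case (less k)
  show ?case
  proof (cases k)
    case 0
    then show ?thesis by (simp add: col_det_def col_prod_def)
  next
    case (Suc k')
    have "last_minor f k' i = col_det f i" if "i \<le> k'" for i
      using that
    proof (induction k' rule: dec_induct)
      case base
      show ?case by (rule last_minor_diag)
    next
      case (step m)
      then show ?case using last_minor_below[of f i m] assms by simp
    qed
    then show ?thesis using less Suc by (simp add: col_det_expand)
  qed
qed

text \<open>The reflection in the antidiagonal exchanges the last column with the first row, so the symmetry
of the determinant needs both expansions.\<close>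

lemma hess_first_row:
  fixes f :: "nat \<Rightarrow> nat \<Rightarrow> 'a::comm_ring_1"
  shows "hess f l (Suc d) = (\<Sum>j\<le>d. f l (l + j) * hess f (l + j + 1) (d - j))"
proof (induction d rule: less_induct)
  case (less d)
  have "hess f l (Suc d) = f l (l + d) + (\<Sum>i<d. f (l + Suc i) (l + d) * hess f l (Suc i))"
    unfolding hess.simps(2)[of f l d] by (subst sum.atMost_shift) simp
  also have "(\<Sum>i<d. f (l + Suc i) (l + d) * hess f l (Suc i))
      = (\<Sum>i<d. \<Sum>j\<le>i. f l (l + j) * (f (l + Suc i) (l + d) * hess f (l + j + 1) (i - j)))"
    by (intro sum.cong refl) (simp add: less sum_distrib_left mult.left_commute del: hess.simps)
  also have "\<dots> = (\<Sum>j<d. \<Sum>i\<in>{j..<d}. f l (l + j) * (f (l + Suc i) (l + d) * hess f (l + j + 1) (i - j)))"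
    unfolding sum.Sigma[OF finite_lessThan ballI[OF finite_atMost]]
      sum.Sigma[OF finite_lessThan ballI[OF finite_atLeastLessThan]]
    by (rule sum.reindex_bij_witness[where i = "\<lambda>(a, b). (b, a)" and j = "\<lambda>(a, b). (b, a)"]) auto
  also have "\<dots> = (\<Sum>j<d. f l (l + j) * hess f (l + j + 1) (d - j))"
  proof (intro sum.cong refl)
    fix j assume j: "j \<in> {..<d}"
    then obtain e where e: "d = j + Suc e" using less_imp_Suc_add by auto
    have "(\<Sum>i\<in>{j..<d}. f (l + Suc i) (l + d) * hess f (l + j + 1) (i - j))
      = (\<Sum>i\<le>e. f (l + j + 1 + i) (l + j + 1 + e) * hess f (l + j + 1) i)"
      by (rule sum.reindex_bij_witness[where i = "\<lambda>i. i + j" and j = "\<lambda>i. i - j"]) (auto simp: e add_ac)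
    then show "(\<Sum>i\<in>{j..<d}. f l (l + j) * (f (l + Suc i) (l + d) * hess f (l + j + 1) (i - j)))
      = f l (l + j) * hess f (l + j + 1) (d - j)"
      by (simp add: e flip: sum_distrib_left)
  qed
  finally show ?case by (simp add: lessThan_Suc_atMost[symmetric] del: hess.simps(2))
qed

lemma hess_reflect:
  fixes f :: "nat \<Rightarrow> nat \<Rightarrow> 'a::comm_ring_1"
  assumes sym: "\<And>i j. i \<le> j \<Longrightarrow> j \<le> n \<Longrightarrow> f i j = f (n - j) (n - i)"
  shows "l + d \<le> Suc n \<Longrightarrow> hess f l d = hess f (Suc n - l - d) d"
proof (induction d arbitrary: l rule: less_induct)
  case (less d)
  show ?case
  proof (cases d)
    case (Suc d')
    have "hess f l (Suc d') = (\<Sum>j\<le>d'. f l (l + j) * hess f (l + j + 1) (d' - j))"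
      by (rule hess_first_row)
    also have "\<dots> = (\<Sum>i\<le>d'. f (n - l - d' + i) (n - l - d' + d') * hess f (n - l - d') i)"
    proof (rule sum.reindex_bij_witness[where i = "\<lambda>i. d' - i" and j = "\<lambda>i. d' - i"])
      fix j assume j: "j \<in> {..d'}"
      have "hess f (l + j + 1) (d' - j) = hess f (n - l - d') (d' - j)"
        using less(1)[of "d' - j" "l + j + 1"] less(2) j Suc by simp
      moreover have "f l (l + j) = f (n - l - d' + (d' - j)) (n - l - d' + d')"
        using sym[of l "l + j"] less(2) j Suc by simp
      ultimately show "f (n - l - d' + (d' - j)) (n - l - d' + d') * hess f (n - l - d') (d' - j)
        = f l (l + j) * hess f (l + j + 1) (d' - j)" by simp
    qed auto
    finally show ?thesis using Suc less(2) by simp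
  qed simp
qed

section \<open>Operators with polynomial coefficients\<close>

text \<open>Operators with polynomial coefficients are stored like \<open>diffop\<close>; this operation and \<open>weyl_mult\<close>
mirror \<open>dleft\<close> and \<open>op_mult\<close>.\<close>

definition weyl_dleft :: "complex poly poly \<Rightarrow> complex poly poly" where
  "weyl_dleft W = pCons 0 W + map_poly pderiv W"

definition weyl_mult :: "complex poly poly \<Rightarrow> complex poly poly \<Rightarrow> complex poly poly" where
  "weyl_mult V W = (\<Sum>i\<le>degree V. smult (coeff V i) ((weyl_dleft ^^ i) W))"

text \<open>Through the action of operators on \<open>\<complex>[t]\<close> products
become compositions, and leading forms can be computed by applying operators to powers of \<open>t\<close>.\<close>

definition act :: "complex poly poly \<Rightarrow> complex poly \<Rightarrow> complex poly" where
  "act W f = (\<Sum>i\<le>degree W. coeff W i * (pderiv ^^ i) f)"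

lemma coeff_weyl_dleft: "coeff (weyl_dleft W) i = coeff (pCons 0 W) i + pderiv (coeff W i)"
  by (simp add: weyl_dleft_def coeff_map_poly)

lemma rderiv_to_fract: "rderiv (to_fract p) = to_fract (pderiv p)"
  by (simp add: to_fract_def rderiv_Fract pderiv_1)

lemma fract_poly_weyl_dleft: "fract_poly (weyl_dleft W) = dleft (fract_poly W)"
  by (rule poly_eqI)
    (simp add: coeff_map_poly coeff_weyl_dleft dleft_def rderiv_to_fract coeff_pCons split: nat.splits)

lemma fract_poly_weyl_dleft_pow: "fract_poly ((weyl_dleft ^^ i) W) = (dleft ^^ i) (fract_poly W)"
  by (induction i) (simp_all add: fract_poly_weyl_dleft)

lemma fract_poly_sum: "fract_poly (sum f A) = (\<Sum>x\<in>A. fract_poly (f x))"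
  by (induction A rule: infinite_finite_induct) simp_all

lemma degree_fract_poly: "degree (fract_poly (W :: complex poly poly)) = degree W"
  by (rule degree_map_poly) simp

lemma fract_poly_weyl_mult: "fract_poly (weyl_mult V W) = op_mult (fract_poly V) (fract_poly W)"
  by (simp add: weyl_mult_def op_mult_def fract_poly_sum degree_fract_poly coeff_map_poly
      fract_poly_weyl_dleft_pow)

lemma act_le: "degree W \<le> N \<Longrightarrow> act W f = (\<Sum>i\<le>N. coeff W i * (pderiv ^^ i) f)"
  unfolding act_def by (rule sum.mono_neutral_left) (auto simp: coeff_eq_0)

lemma act_0 [simp]: "act 0 f = 0"
  by (simp add: act_def)

lemma act_add: "act (V + W) f = act V f + act W f"
proof -
  define N where "N = max (degree V) (degree W)"
  have "degree (V + W) \<le> N" "degree V \<le> N" "degree W \<le> N"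
    using degree_add_le_max[of V W] by (auto simp: N_def)
  then show ?thesis by (simp add: act_le[where N = N] distrib_right sum.distrib)
qed

lemma act_smult: "act (smult c W) f = c * act W f"
  by (simp add: act_le[OF degree_smult_le] act_def[of W] sum_distrib_left mult.assoc)

lemma act_sum: "act (sum g A) f = (\<Sum>x\<in>A. act (g x) f)"
  by (induction A rule: infinite_finite_induct) (simp_all add: act_add)

lemma pderiv_sum_set: "pderiv (sum g A) = (\<Sum>x\<in>A. pderiv (g x))"
  by (induction A rule: infinite_finite_induct) (simp_all add: pderiv_add)

lemma act_pCons_0: "act (pCons 0 W) f = act W (pderiv f)"
proof -
  have "act (pCons 0 W) f = (\<Sum>i\<le>Suc (degree W). coeff (pCons 0 W) i * (pderiv ^^ i) f)"
    by (rule act_le) (simp add: degree_pCons_le)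
  also have "\<dots> = (\<Sum>i\<le>degree W. coeff W i * (pderiv ^^ Suc i) f)"
    unfolding sum.atMost_Suc_shift coeff_pCons_0 coeff_pCons_Suc mult_zero_left add_0_left
    by (rule refl)
  also have "\<dots> = act W (pderiv f)"
    unfolding act_def funpow_Suc_right by simp
  finally show ?thesis .
qed

lemma act_weyl_dleft: "act (weyl_dleft W) f = pderiv (act W f)"
proof -
  have "act (map_poly pderiv W) f = (\<Sum>i\<le>degree W. pderiv (coeff W i) * (pderiv ^^ i) f)"
    by (subst act_le[where N = "degree W"]) (auto simp: coeff_map_poly coeff_eq_0 intro: degree_le)
  moreover have "act (pCons 0 W) f = (\<Sum>i\<le>degree W. coeff W i * (pderiv ^^ Suc i) f)"
    unfolding act_pCons_0 unfolding act_def funpow_Suc_right by simp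
  ultimately show ?thesis
    by (simp add: weyl_dleft_def act_add act_def[of W] pderiv_sum_set pderiv_mult sum.distrib mult.commute)
qed

lemma act_weyl_dleft_pow: "act ((weyl_dleft ^^ i) W) f = (pderiv ^^ i) (act W f)"
  by (induction i) (simp_all add: act_weyl_dleft)

lemma act_weyl_mult: "act (weyl_mult V W) f = act V (act W f)"
  by (simp add: weyl_mult_def act_sum act_smult act_weyl_dleft_pow act_def[of V])


section \<open>Orders and common denominators\<close>

lemma dleft_pow_degree:
  assumes "q \<noteq> 0"
  shows "degree ((dleft ^^ i) q) = i + degree q \<and> lead_coeff ((dleft ^^ i) q) = lead_coeff q"
proof (induction i)
  case (Suc i)
  define r where "r = (dleft ^^ i) q"
  have r: "degree r = i + degree q" "lead_coeff r = lead_coeff q" using Suc by (auto simp: r_def)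
  have "lead_coeff r \<noteq> 0" unfolding r(2) using assms by simp
  then have "r \<noteq> 0" by auto
  then have "degree (map_poly rderiv r) < degree (pCons 0 r)"
    using degree_map_poly_le[of rderiv r] by simp
  then have "degree (dleft r) = degree (pCons 0 r)" 
    unfolding dleft_def by (rule degree_add_eq_left)
  then have d: "degree (dleft r) = Suc (degree r)" using \<open>r \<noteq> 0\<close> by simp
  moreover have "lead_coeff (dleft r) = lead_coeff r"
    unfolding d by (simp add: dleft_def coeff_map_poly coeff_eq_0)
  ultimately show ?case using r by (simp add: r_def)
qed simp

lemma degree_op_mult:
  assumes "p \<noteq> 0" "q \<noteq> 0"
  shows "degree (op_mult p q) = degree p + degree q"
proof (rule antisym)
  show "degree (op_mult p q) \<le> degree p + degree q"
    unfolding op_mult_def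
    by (rule degree_sum_le)
      (auto intro: order.trans[OF degree_smult_le] simp: dleft_pow_degree[OF assms(2)])
  have "coeff (op_mult p q) (degree p + degree q) =
     (\<Sum>i\<le>degree p. if i = degree p then lead_coeff p * lead_coeff q else 0)"
    unfolding op_mult_def coeff_sum
  proof (rule sum.cong)
    fix i assume i: "i \<in> {..degree p}"
    show "coeff (smult (coeff p i) ((dleft ^^ i) q)) (degree p + degree q) =
         (if i = degree p then lead_coeff p * lead_coeff q else 0)"
    proof (cases "i = degree p")
      case True
      have "degree ((dleft ^^ i) q) = degree p + degree q"
        and "lead_coeff ((dleft ^^ i) q) = lead_coeff q"
        unfolding True using dleft_pow_degree[OF assms(2), of "degree p"] by blast+
      then show ?thesis using True by simp
    next
      case False
      then have "degree ((dleft ^^ i) q) < degree p + degree q"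
        using i dleft_pow_degree[OF assms(2), of i] by simp
      then show ?thesis using False by (simp add: coeff_eq_0)
    qed
  qed simp
  then have "coeff (op_mult p q) (degree p + degree q) \<noteq> 0" using assms by simp
  then show "degree p + degree q \<le> degree (op_mult p q)" by (rule le_degree)
qed

lemma fract_poly_pCons: "fract_poly (pCons c W) = pCons (to_fract c) (fract_poly W)"
  by (rule poly_eqI) (simp add: coeff_map_poly coeff_pCons split: nat.splits)

lemma op_mult_0_right: "op_mult p 0 = 0"
proof -
  have "(dleft ^^ i) 0 = 0" for i by (induction i) simp_all
  then show ?thesis by (simp add: op_mult_def)
qed

lemma common_denominator:
  fixes p :: "ratfun poly"
  shows "\<exists>q W. q \<noteq> 0 \<and> smult (to_fract q) p = fract_poly W"
proof (induction p)
  case 0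
  show ?case by (rule exI[of _ 1], rule exI[of _ 0]) simp
next
  case (pCons c p)
  then obtain q W where q: "q \<noteq> 0" "smult (to_fract q) p = fract_poly W" by blast
  obtain a b where c: "c = Fract a b" "b \<noteq> 0" by (cases c) auto
  have "to_fract (q * b) * c = to_fract (q * a)"
    using c by (simp add: Fract_conv_to_fract)
  moreover have "smult (to_fract (q * b)) p = fract_poly (smult b W)"
    using q(2) by (simp add: mult.commute flip: smult_smult)
  ultimately have "smult (to_fract (q * b)) (pCons c p) = fract_poly (pCons (q * a) (smult b W))"
    by (simp add: fract_poly_pCons)
  then show ?case using q(1) c(2) by (metis no_zero_divisors)
qed

text \<open>If \<open>q\<^sub>2 L\<^sub>2\<close> has polynomial coefficients, so has \<open>q\<^sub>1 L\<^sub>1 q\<^sub>2\<^sup>-\<^sup>1\<close> for a suitable \<open>q\<^sub>1\<close>, and the product of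
the two is \<open>q\<^sub>1 L\<^sub>1 L\<^sub>2\<close>.\<close>

lemma factorization_clear_denominators:
  assumes L: "DiffOp (fract_poly W) = L1 * L2" and W: "W \<noteq> 0"
  obtains q V1 V2 where "q \<noteq> 0" "smult q W = weyl_mult V1 V2"
    "degree V1 = op_order L1" "degree V2 = op_order L2" "degree V1 + degree V2 = degree W"
proof -
  define p1 p2 where "p1 = op_poly L1" and "p2 = op_poly L2"
  have W': "fract_poly W = op_mult p1 p2"
    using L by (simp add: times_diffop_def p1_def p2_def)
  have nz: "p1 \<noteq> 0" "p2 \<noteq> 0" using W' W by (auto simp: op_mult_0_right)
  obtain q2 V2 where q2: "q2 \<noteq> 0" "smult (to_fract q2) p2 = fract_poly V2"
    using common_denominator by blast
  define p1' where "p1' = op_mult p1 [:1 / to_fract q2:]"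
  obtain q1 V1 where q1: "q1 \<noteq> 0" "smult (to_fract q1) p1' = fract_poly V1"
    using common_denominator by blast
  have "fract_poly (weyl_mult V1 V2) = smult (to_fract q1) (op_mult p1' (smult (to_fract q2) p2))"
    by (simp add: fract_poly_weyl_mult op_mult_smult flip: q1 q2)
  also have "op_mult p1' (smult (to_fract q2) p2) = op_mult p1 (op_mult [:1 / to_fract q2:] (smult (to_fract q2) p2))"
    by (simp add: p1'_def op_mult_assoc)
  also have "op_mult [:1 / to_fract q2:] (smult (to_fract q2) p2) = p2"
    using q2(1) by (simp add: op_mult_def)
  finally have "fract_poly (weyl_mult V1 V2) = fract_poly (smult q1 W)" by (simp add: W')
  then have eq: "smult q1 W = weyl_mult V1 V2" by (metis fract_poly_eq_iff)
  have "degree p1' = degree p1"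
    unfolding p1'_def using q2(1) by (subst degree_op_mult) (auto simp: nz)
  then have d1: "degree V1 = degree p1" using q1 by (simp flip: degree_fract_poly q1(2))
  have d2: "degree V2 = degree p2" using q2 by (simp flip: degree_fract_poly q2(2))
  have "degree W = degree p1 + degree p2"
    using W' nz degree_op_mult degree_fract_poly by metis
  with q1(1) eq d1 d2 that show ?thesis by (simp add: op_order_def p1_def p2_def)
qed


section \<open>The determinant of type DN as a recursion\<close>

text \<open>The recursion \<open>hess\<close> for operator entries \<open>m i j \<partial>\<^sup>j\<^sup>+\<^sup>1\<^sup>-\<^sup>i\<close>, with the powers of \<open>\<partial>\<close> moved past the
coefficients to their right.\<close>

fun weyl_hess :: "(nat \<Rightarrow> nat \<Rightarrow> complex poly) \<Rightarrow> nat \<Rightarrow> complex poly poly" where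
  "weyl_hess m 0 = 1"
| "weyl_hess m (Suc k) = (\<Sum>i\<le>k. smult (m i k) ((weyl_dleft ^^ (Suc k - i)) (weyl_hess m i)))"

definition char_entry :: "complex mat \<Rightarrow> nat \<Rightarrow> nat \<Rightarrow> complex poly" where
  "char_entry A i j = (if i = j then [:- A $$ (i, j), 1:] else [:- A $$ (i, j):])"

text \<open>The entries of the matrix defining \<open>DN_det\<close>, continued beyond the size of \<open>A\<close> so that the Hessenberg
shape holds for all indices.\<close>

definition DN_entry :: "complex mat \<Rightarrow> nat \<Rightarrow> nat \<Rightarrow> diffop" where
  "DN_entry A i j =
    (if i > j + 1 then 0 else if i = j + 1 then - 1
     else op_fun (to_fract (char_entry A i j)) * op_d ^ (Suc j - i))"

lemma op_poly_add: "op_poly (L + M) = op_poly L + op_poly M"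
  by (simp add: plus_diffop_def)

lemma op_poly_sum: "op_poly (sum f A) = (\<Sum>x\<in>A. op_poly (f x))"
  by (induction A rule: infinite_finite_induct) (simp_all add: op_poly_add zero_diffop_def)

lemma op_poly_fun_mult: "op_poly (op_fun f * L) = smult f (op_poly L)"
  by (simp add: times_diffop_def op_fun_def op_mult_def)

lemma op_poly_d_mult: "op_poly (op_d * L) = dleft (op_poly L)"
  by (simp add: times_diffop_def op_d_def op_mult_def degree_monom_eq monom_Suc monom_0)

lemma op_poly_d_pow_mult: "op_poly (op_d ^ i * L) = (dleft ^^ i) (op_poly L)"
  by (induction i) (simp_all add: mult.assoc op_poly_d_mult)

lemma op_fun_diff: "op_fun f - op_fun g = op_fun (f - g)"
  by (simp add: op_fun_def minus_diffop_def)

lemma op_poly_hess: "op_poly (hess (DN_entry A) 0 k) = fract_poly (weyl_hess (char_entry A) k)"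
proof (induction k rule: less_induct)
  case (less k)
  show ?case
  proof (cases k)
    case 0
    then show ?thesis by (simp add: one_diffop_def)
  next
    case (Suc k')
    have "op_poly (DN_entry A i k' * hess (DN_entry A) 0 i)
        = fract_poly (smult (char_entry A i k') ((weyl_dleft ^^ (Suc k' - i)) (weyl_hess (char_entry A) i)))"
      if "i \<le> k'" for i
    proof -
      have "DN_entry A i k' = op_fun (to_fract (char_entry A i k')) * op_d ^ (Suc k' - i)"
        using that by (simp add: DN_entry_def)
      then show ?thesis using that less[of i] Suc
        by (simp add: mult.assoc op_poly_fun_mult op_poly_d_pow_mult fract_poly_weyl_dleft_pow)
    qed
    then show ?thesis by (simp add: Suc op_poly_sum fract_poly_sum)
  qed
qed

lemma DN_entry_eq:
  assumes "A \<in> DN_params n" "i \<le> n" "j \<le> n"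
  shows "((op_t * op_d) \<cdot>\<^sub>m 1\<^sub>m (Suc n) - DN_tilde n A) $$ (i, j) = DN_entry A i j"
proof -
  have ij: "i < Suc n" "j < Suc n" using assms by auto
  consider "i > j + 1" | "i = j + 1" | "i = j" | "i < j" by linarith
  then show ?thesis
  proof cases
    case 2
    then have "A $$ (i, j) = 1" using assms unfolding DN_params_def by blast
    then show ?thesis using 2 ij by (simp add: DN_tilde_def DN_entry_def op_const_1)
  next
    case 3
    have "to_fract (char_entry A j j) = to_fract [:0, 1:] - to_fract [:A $$ (j, j):]"
      by (simp add: char_entry_def flip: to_fract_diff)
    then show ?thesis using 3 ij
      by (simp add: DN_tilde_def DN_entry_def op_const_def op_t_def left_diff_distrib flip: op_fun_diff)
  next
    case 4
    have "op_fun (to_fract (char_entry A i j)) = - op_const (A $$ (i, j))"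
      using 4 op_const_uminus[of "A $$ (i, j)"] by (simp add: char_entry_def op_const_def)
    then show ?thesis using 4 ij by (simp add: DN_tilde_def DN_entry_def)
  qed (use ij in \<open>simp add: DN_tilde_def DN_entry_def\<close>)
qed

lemma DN_det_eq_hess:
  assumes A: "A \<in> DN_params n"
  shows "DN_det n A = hess (DN_entry A) 0 (Suc n)"
proof -
  let ?M = "(op_t * op_d) \<cdot>\<^sub>m 1\<^sub>m (Suc n) - DN_tilde n A"
  have dim: "dim_row ?M = Suc n" by (simp add: DN_tilde_def)
  have "map (\<lambda>j. ?M $$ (p j, j)) (rev [0..<Suc n]) = map (\<lambda>j. DN_entry A (p j) j) (rev [0..<Suc n])"
    if p: "p permutes {..<Suc n}" for p
  proof (rule map_cong)
    fix j assume "j \<in> set (rev [0..<Suc n])"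
    then have "j < Suc n" by auto
    moreover from this have "p j < Suc n" using permutes_in_image[OF p, of j] by simp
    ultimately show "?M $$ (p j, j) = DN_entry A (p j) j" 
      using DN_entry_eq[OF A, of "p j" j] by (simp add: less_Suc_eq_le)
  qed simp
  then have "DN_det n A = col_det (DN_entry A) (Suc n)"
    unfolding DN_det_def det_right_def col_det_def col_prod_def dim
    by (intro sum.cong refl) (simp only: mem_Collect_eq)
  also have "\<dots> = hess (DN_entry A) 0 (Suc n)"
    by (rule col_det_eq_hess) (simp_all add: DN_entry_def)
  finally show ?thesis .
qed

lemma DN_op_poly:
  assumes "A \<in> DN_params n"
  obtains W where "DN_op n A = DiffOp (fract_poly W)" "weyl_hess (char_entry A) (Suc n) = pCons 0 W"
proof -
  let ?Q = "weyl_hess (char_entry A) (Suc n)"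
  have eq: "pCons 0 (op_poly (DN_op n A)) = fract_poly ?Q"
    by (metis DN_op_mult_d DN_det_eq_hess[OF assms] op_poly_hess op_poly_mult_d)
  obtain c W where Q: "?Q = pCons c W" by (cases ?Q)
  have "pCons 0 (op_poly (DN_op n A)) = pCons (to_fract c) (fract_poly W)"
    using eq unfolding Q by (simp add: fract_poly_pCons)
  then have "c = 0" "op_poly (DN_op n A) = fract_poly W" by auto
  then show ?thesis using that Q by (metis diffop.collapse)
qed

section \<open>The two leading coefficients\<close>

text \<open>\<open>u\<close> and \<open>v\<close> are the coefficients of \<open>\<partial>\<^sup>k\<close> and \<open>\<partial>\<^sup>k\<^sup>-\<^sup>1\<close> in an operator of order at most \<open>k\<close>; shifting by
\<open>pCons\<close> makes \<open>v = 0\<close> for \<open>k = 0\<close>.\<close>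

definition leading_pair :: "complex poly poly \<Rightarrow> nat \<Rightarrow> complex poly \<Rightarrow> complex poly \<Rightarrow> bool" where
  "leading_pair W k u v \<longleftrightarrow> degree W \<le> k \<and> coeff W k = u \<and> coeff (pCons 0 W) k = v"

lemma leading_pair_weyl_dleft:
  assumes "leading_pair W k u v"
  shows "leading_pair (weyl_dleft W) (Suc k) u (v + pderiv u)"
proof -
  have "degree (weyl_dleft W) \<le> Suc k"
    using assms by (intro degree_le) (auto simp: leading_pair_def coeff_weyl_dleft coeff_pCons coeff_eq_0 split: nat.splits)
  then show ?thesis using assms by (auto simp: leading_pair_def coeff_weyl_dleft coeff_eq_0)
qed

lemma leading_pair_weyl_dleft_pow:
  assumes "leading_pair W k u v"
  shows "leading_pair ((weyl_dleft ^^ e) W) (k + e) u (v + of_nat e * pderiv u)"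
proof (induction e)
  case (Suc e)
  from leading_pair_weyl_dleft[OF this] show ?case by (simp add: algebra_simps)
qed (use assms in simp)

lemma leading_pair_smult: "leading_pair W k u v \<Longrightarrow> leading_pair (smult p W) k (p * u) (p * v)"
  by (auto simp: leading_pair_def coeff_pCons intro: order.trans[OF degree_smult_le] split: nat.splits)

lemma leading_pair_sum:
  assumes "\<And>i. i \<in> I \<Longrightarrow> leading_pair (W i) k (u i) (v i)"
  shows "leading_pair (sum W I) k (sum u I) (sum v I)"
proof (cases "finite I")
  case True
  then have "degree (sum W I) \<le> k"
    by (rule degree_sum_le) (use assms in \<open>auto simp: leading_pair_def\<close>)
  moreover have "coeff (sum W I) k = sum u I"
    using assms by (auto simp: coeff_sum leading_pair_def)
  moreover have "coeff (pCons 0 (sum W I)) k = sum v I"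
    using assms by (cases k) (auto simp: coeff_sum leading_pair_def intro!: sum.cong sum.neutral)
  ultimately show ?thesis by (simp add: leading_pair_def)
qed (simp add: leading_pair_def coeff_pCons split: nat.splits)

text \<open>Deleting row and column \<open>l\<close> splits a Hessenberg block into the blocks before and after \<open>l\<close>. Expanding
the second one along its last column gives the left-hand side, grouped by \<open>l\<close>.\<close>

lemma hess_weighted_sum:
  fixes m :: "nat \<Rightarrow> nat \<Rightarrow> 'a::comm_ring_1"
  shows "(\<Sum>i\<le>k. m i k * (\<Sum>l<i. w l * (hess m 0 l * hess m (Suc l) (i - 1 - l))))
    = (\<Sum>l<k. w l * (hess m 0 l * hess m (Suc l) (k - l)))"
proof -
  have "(\<Sum>i\<le>k. m i k * (\<Sum>l<i. w l * (hess m 0 l * hess m (Suc l) (i - 1 - l))))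
    = (\<Sum>i\<le>k. \<Sum>l<i. w l * hess m 0 l * (m i k * hess m (Suc l) (i - 1 - l)))"
    by (simp add: sum_distrib_left algebra_simps)
  also have "\<dots> = (\<Sum>l<k. \<Sum>i\<in>{l<..k}. w l * hess m 0 l * (m i k * hess m (Suc l) (i - 1 - l)))"
    unfolding sum.Sigma[OF finite_atMost ballI[OF finite_lessThan]]
      sum.Sigma[OF finite_lessThan ballI[OF finite_greaterThanAtMost]]
    by (rule sum.reindex_bij_witness[where i = "\<lambda>(a, b). (b, a)" and j = "\<lambda>(a, b). (b, a)"]) auto
  also have "\<dots> = (\<Sum>l<k. w l * (hess m 0 l * hess m (Suc l) (k - l)))"
  proof (intro sum.cong refl)
    fix l assume l: "l \<in> {..<k}"
    then obtain e where e: "k = l + Suc e" using less_imp_Suc_add by auto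
    have "(\<Sum>i\<in>{l<..k}. m i k * hess m (Suc l) (i - 1 - l))
      = (\<Sum>i\<le>e. m (Suc l + i) (Suc l + e) * hess m (Suc l) i)"
      by (rule sum.reindex_bij_witness[where i = "\<lambda>i. Suc l + i" and j = "\<lambda>i. i - Suc l"]) (auto simp: e)
    then show "(\<Sum>i\<in>{l<..k}. w l * hess m 0 l * (m i k * hess m (Suc l) (i - 1 - l)))
      = w l * (hess m 0 l * hess m (Suc l) (k - l))"
      by (simp add: e mult.assoc flip: sum_distrib_left)
  qed
  finally show ?thesis .
qed

text \<open>The derivative of a characteristic polynomial is the sum of the principal minors of corank one, and
each of them factors because of the Hessenberg shape.\<close>

lemma pderiv_hess:
  fixes m :: "nat \<Rightarrow> nat \<Rightarrow> complex poly"
  assumes m: "\<And>i j. pderiv (m i j) = (if i = j then 1 else 0)"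
  shows "pderiv (hess m 0 k) = (\<Sum>l<k. hess m 0 l * hess m (Suc l) (k - 1 - l))"
proof (induction k rule: less_induct)
  case (less k)
  show ?case
  proof (cases k)
    case (Suc k')
    have "pderiv (hess m 0 (Suc k')) =
        (\<Sum>i\<le>k'. m i k' * pderiv (hess m 0 i)) + (\<Sum>i\<le>k'. if i = k' then hess m 0 i else 0)"
      unfolding sum.distrib[symmetric]
      by (auto simp: pderiv_sum_set pderiv_mult m intro!: sum.cong)
    also have "(\<Sum>i\<le>k'. m i k' * pderiv (hess m 0 i))
        = (\<Sum>i\<le>k'. m i k' * (\<Sum>l<i. 1 * (hess m 0 l * hess m (Suc l) (i - 1 - l))))"
      using less Suc by simp
    also have "\<dots> = (\<Sum>l<k'. 1 * (hess m 0 l * hess m (Suc l) (k' - l)))"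
      by (rule hess_weighted_sum)
    finally show ?thesis by (simp add: Suc del: hess.simps(2))
  qed simp
qed

text \<open>The coefficient below the leading one arises from a single differentiation of a diagonal entry
\<open>t - a\<^sub>l\<^sub>l\<close> by a \<open>\<partial>\<close> to its left. The total power of \<open>\<partial>\<close> in the columns after \<open>l\<close> is their number
\<open>k - 1 - l\<close>, whichever permutation of these columns is taken.\<close>

lemma leading_pair_weyl_hess:
  assumes m: "\<And>i j. pderiv (m i j) = (if i = j then 1 else 0)"
  shows "leading_pair (weyl_hess m k) k (hess m 0 k)
    (\<Sum>l<k. of_nat (k - 1 - l) * (hess m 0 l * hess m (Suc l) (k - 1 - l)))"
proof (induction k rule: less_induct)
  case (less k)
  let ?g = "\<lambda>k l. hess m 0 l * hess m (Suc l) (k - 1 - l)"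
  show ?case
  proof (cases k)
    case 0
    then show ?thesis by (simp add: leading_pair_def)
  next
    case (Suc k')
    have "leading_pair (smult (m i k') ((weyl_dleft ^^ (Suc k' - i)) (weyl_hess m i))) k
        (m i k' * hess m 0 i) (m i k' * (\<Sum>l<i. of_nat (k' - l) * ?g i l))" if "i \<in> {..k'}" for i
    proof -
      have "(\<Sum>l<i. of_nat (i - 1 - l) * ?g i l) + of_nat (Suc k' - i) * pderiv (hess m 0 i)
        = (\<Sum>l<i. (of_nat (i - 1 - l) + of_nat (Suc k' - i)) * ?g i l)"
        unfolding pderiv_hess[of m, OF m] by (simp add: sum_distrib_left sum.distrib distrib_right)
      also have "\<dots> = (\<Sum>l<i. of_nat (k' - l) * ?g i l)"
      proof (intro sum.cong refl)
        fix l assume "l \<in> {..<i}"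
        then have "(i - 1 - l) + (Suc k' - i) = k' - l" using that by auto
        then show "(of_nat (i - 1 - l) + of_nat (Suc k' - i)) * ?g i l = of_nat (k' - l) * ?g i l"
          by (metis of_nat_add)
      qed
      finally have eq: "(\<Sum>l<i. of_nat (i - 1 - l) * ?g i l) + of_nat (Suc k' - i) * pderiv (hess m 0 i)
        = (\<Sum>l<i. of_nat (k' - l) * ?g i l)" .
      have "i < k" "i + (Suc k' - i) = k" using that Suc by auto
      with leading_pair_smult[OF leading_pair_weyl_dleft_pow[OF less[of i], of "Suc k' - i"], of "m i k'"]
      show ?thesis unfolding eq by simp
    qed
    then have "leading_pair (\<Sum>i\<le>k'. smult (m i k') ((weyl_dleft ^^ (Suc k' - i)) (weyl_hess m i))) k
        (\<Sum>i\<le>k'. m i k' * hess m 0 i) (\<Sum>i\<le>k'. m i k' * (\<Sum>l<i. of_nat (k' - l) * ?g i l))"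
      by (rule leading_pair_sum)
    then show ?thesis unfolding hess_weighted_sum[of m k' "\<lambda>l. of_nat (k' - l)"] by (simp add: Suc)
  qed
qed

text \<open>The reflection in the antidiagonal exchanges the minors for \<open>l\<close> and \<open>n - l\<close>, so the weights \<open>n - l\<close>
may be replaced by their average \<open>n/2\<close>.\<close>

lemma weighted_sum_symmetric:
  fixes m :: "nat \<Rightarrow> nat \<Rightarrow> 'a::comm_ring_1"
  assumes sym: "\<And>i j. i \<le> j \<Longrightarrow> j \<le> n \<Longrightarrow> m i j = m (n - j) (n - i)"
  shows "2 * (\<Sum>l<Suc n. of_nat (n - l) * (hess m 0 l * hess m (Suc l) (n - l)))
    = of_nat n * (\<Sum>l<Suc n. hess m 0 l * hess m (Suc l) (n - l))"
proof -
  \<comment> \<open>The principal minor that remains after deleting row and column \<open>l\<close>.\<close>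
  define g where "g l = hess m 0 l * hess m (Suc l) (n - l)" for l
  have g: "g (n - l) = g l" if "l \<le> n" for l
    using that hess_reflect[of n m 0 "n - l", OF sym] hess_reflect[of n m "Suc (n - l)" l, OF sym]
    by (simp add: g_def Suc_diff_le mult.commute)
  have "(\<Sum>l<Suc n. of_nat (n - l) * g l) = (\<Sum>l<Suc n. of_nat l * g l)"
    by (rule sum.reindex_bij_witness[where i = "\<lambda>l. n - l" and j = "\<lambda>l. n - l"]) (auto simp: g)
  then have "2 * (\<Sum>l<Suc n. of_nat (n - l) * g l) =
      (\<Sum>l<Suc n. of_nat (n - l) * g l) + (\<Sum>l<Suc n. of_nat l * g l)" by (simp only: mult_2)
  also have "\<dots> = (\<Sum>l<Suc n. of_nat n * g l)"
    unfolding sum.distrib[symmetric]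
  proof (intro sum.cong refl)
    fix l assume "l \<in> {..<Suc n}"
    then have "(n - l) + l = n" by auto
    then show "of_nat (n - l) * g l + of_nat l * g l = of_nat n * g l"
      by (metis distrib_right of_nat_add)
  qed
  also have "\<dots> = of_nat n * (\<Sum>l<Suc n. g l)" by (rule sum_distrib_left[symmetric])
  finally show ?thesis unfolding g_def .
qed

lemma degree_hess_char_entry:
  "degree (hess (char_entry A) 0 k) = k \<and> lead_coeff (hess (char_entry A) 0 k) = 1"
proof (induction k rule: less_induct)
  case (less k)
  show ?case
  proof (cases k)
    case (Suc k')
    define h where "h = hess (char_entry A) 0"
    have IH: "degree (h i) = i" "lead_coeff (h i) = 1" if "i \<le> k'" for i
      using less[of i] that Suc by (auto simp: h_def)
    have hk: "h k' \<noteq> 0" using IH(2)[of k'] by auto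
    have eq: "h (Suc k') = (\<Sum>i<k'. char_entry A i k' * h i) + char_entry A k' k' * h k'"
      by (simp add: h_def lessThan_Suc_atMost[symmetric])
    have entry: "char_entry A k' k' \<noteq> 0" "degree (char_entry A k' k') = 1"
      "lead_coeff (char_entry A k' k') = 1"
      by (simp_all add: char_entry_def)
    have top: "degree (char_entry A k' k' * h k') = Suc k'"
      "lead_coeff (char_entry A k' k' * h k') = 1"
      using hk IH[of k'] entry lead_coeff_mult[of "char_entry A k' k'" "h k'"]
      by (simp_all add: degree_mult_eq)
    have "degree (\<Sum>i<k'. char_entry A i k' * h i) \<le> k'"
      by (rule degree_sum_le) (use IH in \<open>auto simp: char_entry_def\<close>)
    then have lt: "degree (\<Sum>i<k'. char_entry A i k' * h i) < degree (char_entry A k' k' * h k')"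
      using top by simp
    moreover from this have "coeff (\<Sum>i<k'. char_entry A i k' * h i) (Suc k') = 0"
      unfolding top(1) by (rule coeff_eq_0)
    ultimately have "degree (h (Suc k')) = Suc k'" "lead_coeff (h (Suc k')) = 1"
      unfolding eq using top by (simp_all add: degree_add_eq_right)
    then show ?thesis using Suc h_def by simp
  qed simp
qed

lemma pderiv_char_entry: "pderiv (char_entry A i j) = (if i = j then 1 else 0)"
  by (simp add: char_entry_def pderiv_pCons flip: one_pCons)

lemma coeff_pderiv_pow_ge:
  assumes "degree (p :: complex poly) \<le> x" "e > 0" "j \<ge> x"
  shows "coeff ((pderiv ^^ e) p) j = 0"
  using assms by (simp add: coeff_higher_pderiv coeff_eq_0)

text \<open>An entry \<open>a\<^sub>i\<^sub>j \<partial>\<^sup>j\<^sup>+\<^sup>1\<^sup>-\<^sup>i\<close> lowers degrees, and so only the summand \<open>t \<partial>\<close> of the diagonal entries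
contributes to the leading term: up to lower degree, the determinant acts as \<open>(t \<partial>)\<^sup>k\<close>.\<close>

lemma act_weyl_hess:
  "degree (act (weyl_hess (char_entry A) k) (monom 1 x)) \<le> x \<and>
   coeff (act (weyl_hess (char_entry A) k) (monom 1 x)) x = of_nat x ^ k"
proof (induction k rule: less_induct)
  case (less k)
  show ?case
  proof (cases k)
    case 0
    then show ?thesis by (simp add: act_def degree_monom_eq)
  next
    case (Suc k')
    define p where "p i = act (weyl_hess (char_entry A) i) (monom 1 x)" for i
    have IH: "degree (p i) \<le> x" "coeff (p i) x = of_nat x ^ i" if "i \<le> k'" for i
      using less[of i] that Suc by (auto simp: p_def)
    have eq: "p (Suc k') = (\<Sum>i<k'. char_entry A i k' * (pderiv ^^ (Suc k' - i)) (p i))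
        + char_entry A k' k' * pderiv (p k')"
      by (simp add: p_def act_add act_sum act_smult act_weyl_dleft act_weyl_dleft_pow lessThan_Suc_atMost[symmetric])
    have low: "coeff (\<Sum>i<k'. char_entry A i k' * (pderiv ^^ (Suc k' - i)) (p i)) j = 0"
      if "j \<ge> x" for j
      unfolding coeff_sum
    proof (rule sum.neutral, rule ballI)
      fix i assume "i \<in> {..<k'}"
      then show "coeff (char_entry A i k' * (pderiv ^^ (Suc k' - i)) (p i)) j = 0"
        using coeff_pderiv_pow_ge[OF IH(1)[of i], of "Suc k' - i" j] that
        by (simp add: char_entry_def)
    qed
    have z: "coeff (p k') (Suc j) = 0" if "j \<ge> x" for j
      using IH(1)[of k'] that by (simp add: coeff_eq_0)
    have top: "coeff (char_entry A k' k' * pderiv (p k')) j = (if j = x then of_nat x ^ Suc k' else 0)"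
      if "j \<ge> x" for j
    proof -
      have "coeff (char_entry A k' k' * pderiv (p k')) j = coeff (pCons 0 (pderiv (p k'))) j"
        by (simp add: char_entry_def coeff_pderiv z[OF that])
      also have "\<dots> = of_nat j * coeff (p k') j" by (cases j) (simp_all add: coeff_pderiv)
      also have "\<dots> = (if j = x then of_nat x ^ Suc k' else 0)"
      proof (cases "j = x")
        case False
        with that obtain i where "j = Suc i" "i \<ge> x" by (cases j) auto
        then show ?thesis using False z by simp
      qed (use IH(2) in simp)
      finally show ?thesis .
    qed
    have "degree (p (Suc k')) \<le> x"
      unfolding eq by (rule degree_le) (simp add: low top)
    moreover have "coeff (p (Suc k')) x = of_nat x ^ Suc k'" by (simp add: eq low top)
    ultimately show ?thesis by (simp add: p_def Suc)
  qed
qed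

section \<open>Sums of roots of divisors\<close>

definition falling_poly :: "nat \<Rightarrow> complex poly" where
  "falling_poly k = (\<Prod>j<k. [:- of_nat j, 1:])"

text \<open>The coefficient of \<open>t\<^sup>x\<^sup>+\<^sup>w\<close> in \<open>W t\<^sup>x\<close>, as a polynomial in \<open>x\<close>; the falling factorials come from
\<open>\<partial>\<^sup>i t\<^sup>x\<close>. For the lowest \<open>w\<close> that occurs this is the indicial polynomial at \<open>0\<close>, for the highest one
that at infinity.\<close>

definition indicial :: "complex poly poly \<Rightarrow> int \<Rightarrow> complex poly" where
  "indicial W w = (\<Sum>i\<le>degree W. smult (coeff_int (coeff W i) (int i + w)) (falling_poly i))"

lemma falling_poly_Suc: "falling_poly (Suc k) = falling_poly k * [:- of_nat k, 1:]"
  by (simp add: falling_poly_def)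

lemma falling_poly_0 [simp]: "falling_poly 0 = 1"
  by (simp add: falling_poly_def)

lemma falling_poly_nz [simp]: "falling_poly k \<noteq> 0"
  by (simp add: falling_poly_def)

lemma degree_falling_poly [simp]: "degree (falling_poly k) = k"
  unfolding falling_poly_def by (subst degree_prod_eq_sum_degree) auto

lemma coeff_falling_poly_self: "coeff (falling_poly k) k = 1"
proof -
  have "lead_coeff (falling_poly k) = 1" unfolding falling_poly_def by (simp add: lead_coeff_prod)
  then show ?thesis by simp
qed

text \<open>The sum of the roots with multiplicities, by Vieta. The shift by \<open>pCons\<close> gives \<open>0\<close> for constants.\<close>

definition rootsum :: "complex poly \<Rightarrow> complex" where
  "rootsum q = - coeff (pCons 0 q) (degree q) / lead_coeff q"

lemma rootsum_mult_linear:
  assumes "q \<noteq> 0"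
  shows "rootsum (q * [:- r, 1:]) = rootsum q + r"
proof -
  have d: "degree (q * [:- r, 1:]) = Suc (degree q)"
    using assms by (subst degree_mult_eq) auto
  have "lead_coeff (q * [:- r, 1:]) = lead_coeff q" by (subst lead_coeff_mult) simp
  moreover have "coeff (q * [:- r, 1:]) (degree q) = coeff (pCons 0 q) (degree q) - r * lead_coeff q"
    by (simp add: mult.commute[of q] mult_pCons_left)
  ultimately show ?thesis
    using assms unfolding rootsum_def d by (simp add: field_simps)
qed

lemma rootsum_falling_poly: "rootsum (falling_poly k) = of_nat k * (of_nat k - 1) / 2"
proof (induction k)
  case (Suc k)
  have "rootsum (falling_poly (Suc k)) = rootsum (falling_poly k) + of_nat k"
    unfolding falling_poly_Suc by (rule rootsum_mult_linear) simp
  then show ?case using Suc by (simp add: field_simps)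
qed (simp add: rootsum_def)

lemma dvd_mult_linear_cases:
  fixes q f :: "complex poly"
  assumes "q dvd f * [:- r, 1:]"
  obtains "q dvd f" | q' where "q = q' * [:- r, 1:]" "q' dvd f"
proof -
  let ?x = "[:- r, 1:]"
  have x: "?x \<noteq> 0" by simp
  from assms obtain g where g: "f * ?x = q * g" by (rule dvdE)
  have "poly (q * g) r = 0" unfolding g[symmetric] by simp
  then have "poly q r = 0 \<or> poly g r = 0" by simp
  then show ?thesis
  proof
    assume "poly q r = 0"
    then obtain q' where q': "q = q' * ?x" unfolding poly_eq_0_iff_dvd by (metis dvdE mult.commute)
    have "f * ?x = (q' * g) * ?x" by (simp only: g q' mult_ac)
    then have "f = q' * g" using x by (metis mult_right_cancel)
    then show ?thesis using that q' by auto
  next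
    assume "poly g r = 0"
    then obtain g' where g': "g = g' * ?x" unfolding poly_eq_0_iff_dvd by (metis dvdE mult.commute)
    have "f * ?x = (q * g') * ?x" by (simp only: g g' mult_ac)
    then have "f = q * g'" using x by (metis mult_right_cancel)
    then show ?thesis using that by auto
  qed
qed

text \<open>The roots of \<open>q\<close> are distinct elements of \<open>{0, \<dots>, n - 1}\<close>, and their sum is least when they are
\<open>0, \<dots>, degree q - 1\<close>.\<close>

lemma rootsum_dvd_falling_poly:
  "q dvd falling_poly n \<Longrightarrow> Re (rootsum q) \<ge> real (degree q) * (real (degree q) - 1) / 2"
proof (induction n arbitrary: q)
  case 0
  then have "degree q = 0" by (metis falling_poly_0 poly_dvd_1)
  then show ?case by (simp add: rootsum_def)
next
  case (Suc n)
  from Suc.prems have "q dvd falling_poly n * [:- of_nat n, 1:]" by (simp add: falling_poly_Suc)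
  then show ?case
  proof (cases rule: dvd_mult_linear_cases)
    case 1
    then show ?thesis by (rule Suc.IH)
  next
    case (2 q')
    then have nz: "q' \<noteq> 0" by auto
    have d: "degree q = Suc (degree q')" using nz unfolding 2 by (subst degree_mult_eq) auto
    have "degree q' \<le> n" using dvd_imp_degree_le[OF 2(2)] by simp
    moreover have "rootsum q = rootsum q' + of_nat n" unfolding 2 by (rule rootsum_mult_linear[OF nz])
    moreover note Suc.IH[OF 2(2)]
    ultimately show ?thesis unfolding d by (simp add: field_simps)
  qed
qed

text \<open>At most one root of \<open>q\<close> is taken from the extra factor; the others are distinct natural numbers.\<close>

lemma rootsum_dvd_falling_poly_linear:
  assumes "q dvd falling_poly (n - 1) * [:- of_real r, 1:]" "degree q > 0"
  shows "Re (rootsum q) \<ge> real (degree q) * (real (degree q) - 1) / 2 + min 0 (r - (real (degree q) - 1))"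
  using assms(1)
proof (cases rule: dvd_mult_linear_cases)
  case 1
  from rootsum_dvd_falling_poly[OF this] show ?thesis
    using min.cobounded1[of 0 "r - (real (degree q) - 1)"] by linarith
next
  case (2 q')
  then have nz: "q' \<noteq> 0" by auto
  have d: "degree q = Suc (degree q')" using nz unfolding 2 by (subst degree_mult_eq) auto
  have "rootsum q = rootsum q' + of_real r" unfolding 2 by (rule rootsum_mult_linear[OF nz])
  with rootsum_dvd_falling_poly[OF 2(2)] show ?thesis unfolding d by (simp add: field_simps min_def)
qed

lemma rootsum_dvd_power: "q dvd [:1, 1:] ^ m \<Longrightarrow> rootsum q = - of_nat (degree q)"
proof (induction m arbitrary: q)
  case 0
  then have "degree q = 0" by (metis power_0 poly_dvd_1)
  then show ?case by (simp add: rootsum_def)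
next
  case (Suc m)
  from Suc.prems have "q dvd [:1, 1:] ^ m * [:- (-1), 1:]" by (simp add: mult.commute)
  then show ?case
  proof (cases rule: dvd_mult_linear_cases)
    case 1
    then show ?thesis by (rule Suc.IH)
  next
    case (2 q')
    then have nz: "q' \<noteq> 0" by auto
    have d: "degree q = Suc (degree q')" using nz unfolding 2 by (subst degree_mult_eq) auto
    have "rootsum q = rootsum q' + (-1)" unfolding 2 by (rule rootsum_mult_linear[OF nz])
    then show ?thesis using Suc.IH[OF 2(2)] unfolding d by simp
  qed
qed


section \<open>Indicial polynomials\<close>

lemma pderiv_pow_monom: "(pderiv ^^ i) (monom 1 x) = monom (poly (falling_poly i) (of_nat x)) (x - i)"
proof (induction i)
  case (Suc i)
  have "of_nat (x - i) * poly (falling_poly i) (of_nat x) = poly (falling_poly (Suc i)) (of_nat x :: complex)"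
  proof (cases "i \<le> x")
    case True
    then show ?thesis by (simp add: falling_poly_Suc of_nat_diff algebra_simps)
  next
    case False
    then have "poly (falling_poly i) (of_nat x) = 0" by (auto simp: falling_poly_def poly_prod intro!: bexI[of _ x])
    then show ?thesis by (simp add: falling_poly_Suc)
  qed
  then show ?case using Suc by (simp add: pderiv_monom)
qed simp

text \<open>For \<open>i > x\<close> both sides of the termwise identity vanish, the right one because \<open>x\<close> is a root of the
falling factorial; truncated subtraction in the exponent \<open>x - i\<close> is therefore harmless.\<close>

lemma coeff_act_monom:
  "coeff (act W (monom 1 x)) j = poly (indicial W (int j - int x)) (of_nat x)"
proof -
  have "coeff (p * (pderiv ^^ i) (monom 1 x)) j
      = coeff_int p (int i + (int j - int x)) * poly (falling_poly i) (of_nat x)" for p i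
  proof (cases "i \<le> x")
    case True
    then have "x - i \<le> j \<longleftrightarrow> \<not> int i + (int j - int x) < 0"
      and "x - i \<le> j \<Longrightarrow> nat (int i + (int j - int x)) = j - (x - i)" by auto
    then show ?thesis
      by (auto simp: pderiv_pow_monom mult.commute[of p] coeff_monom_mult coeff_int_def)
  next
    case False
    then have "poly (falling_poly i) (of_nat x) = 0" by (auto simp: falling_poly_def poly_prod intro!: bexI[of _ x])
    then show ?thesis by (simp add: pderiv_pow_monom)
  qed
  then show ?thesis by (simp add: act_def coeff_sum indicial_def poly_sum)
qed

lemma higher_pderiv_add: "(pderiv ^^ i) (f + g) = (pderiv ^^ i) f + (pderiv ^^ i) g"
  by (induction i) (simp_all add: pderiv_add)

lemma higher_pderiv_smult: "(pderiv ^^ i) (smult c f) = smult c ((pderiv ^^ i) f)"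
  by (induction i) (simp_all add: pderiv_smult)

lemma act_add_right: "act W (f + g) = act W f + act W g"
  by (simp add: act_def higher_pderiv_add distrib_left sum.distrib)

lemma act_smult_right: "act W (smult c f) = smult c (act W f)"
  by (simp add: act_def higher_pderiv_smult smult_sum2)

lemma act_sum_right: "act W (sum f A) = (\<Sum>x\<in>A. act W (f x))"
proof (induction A rule: infinite_finite_induct)
  case empty
  show ?case using act_smult_right[of W 0 0] by simp
next
  case (infinite A)
  then show ?case using act_smult_right[of W 0 0] by simp
qed (simp_all add: act_add_right)

lemma coeff_act:
  assumes "degree f \<le> N"
  shows "coeff (act W f) j = (\<Sum>l\<le>N. coeff f l * poly (indicial W (int j - int l)) (of_nat l))"
proof -
  have "f = (\<Sum>l\<le>N. smult (coeff f l) (monom 1 l))"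
    using poly_as_sum_of_monoms'[OF assms] by (simp add: smult_monom)
  then have "act W f = (\<Sum>l\<le>N. smult (coeff f l) (act W (monom 1 l)))"
    by (metis (no_types, lifting) act_smult_right act_sum_right sum.cong)
  then show ?thesis by (simp add: coeff_sum coeff_act_monom)
qed

lemma poly_eq_of_large_nat:
  fixes p q :: "complex poly"
  assumes "\<And>x. x \<ge> N \<Longrightarrow> poly p (of_nat x) = poly q (of_nat x)"
  shows "p = q"
proof (rule ccontr)
  assume "p \<noteq> q"
  then have "finite {z. poly (p - q) z = 0}" by (intro poly_roots_finite) simp
  moreover have "of_nat ` {N..} \<subseteq> {z. poly (p - q) z = 0}" using assms by auto
  ultimately have "finite (of_nat ` {N..} :: complex set)" by (rule finite_subset[rotated])
  then have "finite {N..}" by (rule finite_imageD) (auto simp: inj_on_def)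
  then show False by (simp add: infinite_Ici)
qed

text \<open>In the composition the coefficient of weight \<open>v\<^sub>0 + w\<^sub>0\<close> collects all pairs of weights with this sum.
If \<open>(v\<^sub>0, w\<^sub>0)\<close> is the only pair for which both operators have a component, a single product remains,
in which the second operator is applied to \<open>t\<^sup>x\<^sup>+\<^sup>w\<close> with \<open>w = w\<^sub>0\<close>.\<close>

lemma indicial_comp:
  assumes comp: "\<And>f. act U f = act V (act W f)"
    and ext: "\<And>v w. v + w = v0 + w0 \<Longrightarrow> w \<noteq> w0 \<Longrightarrow> indicial V v = 0 \<or> indicial W w = 0"
  shows "indicial U (v0 + w0) = indicial W w0 * pcompose (indicial V v0) [:of_int w0, 1:]"
proof (rule poly_eq_of_large_nat)
  fix x assume x: "x \<ge> nat \<bar>w0\<bar> + nat \<bar>v0\<bar>"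
  define j l0 where "j = nat (int x + v0 + w0)" and "l0 = nat (int x + w0)"
  have j: "int j = int x + v0 + w0" and l0: "int l0 = int x + w0"
    using x by (auto simp: j_def l0_def)
  define g where "g = act W (monom 1 x)"
  define N where "N = max (degree g) l0"
  have "poly (indicial U (v0 + w0)) (of_nat x) = coeff (act U (monom 1 x)) j"
    by (simp add: coeff_act_monom j add.assoc)
  also have "\<dots> = (\<Sum>l\<le>N. coeff g l * poly (indicial V (int j - int l)) (of_nat l))"
    unfolding comp g_def[symmetric] by (rule coeff_act) (simp add: N_def)
  also have "\<dots> = (\<Sum>l\<le>N. if l = l0 then coeff g l * poly (indicial V (int j - int l)) (of_nat l) else 0)"
  proof (rule sum.cong[OF refl])
    fix l
    show "coeff g l * poly (indicial V (int j - int l)) (of_nat l)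
      = (if l = l0 then coeff g l * poly (indicial V (int j - int l)) (of_nat l) else 0)"
    proof (cases "l = l0")
      case False
      then have "int l - int x \<noteq> w0" using l0 by linarith
      with ext[of "int j - int l" "int l - int x"] have "indicial V (int j - int l) = 0 \<or> indicial W (int l - int x) = 0"
        by (simp add: j)
      then show ?thesis using False by (auto simp: g_def coeff_act_monom)
    qed simp
  qed
  also have "\<dots> = coeff g l0 * poly (indicial V (int j - int l0)) (of_nat l0)"
    by (simp add: N_def)
  also have "\<dots> = poly (indicial W w0) (of_nat x) * poly (indicial V v0) (of_nat x + of_int w0)"
  proof -
    have "int j - int l0 = v0" "int l0 - int x = w0" using j l0 by auto
    moreover have "(of_nat l0 :: complex) = of_nat x + of_int w0" using l0 by (metis of_int_add of_int_of_nat_eq)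
    ultimately show ?thesis by (simp add: g_def coeff_act_monom)
  qed
  finally show "poly (indicial U (v0 + w0)) (of_nat x)
      = poly (indicial W w0 * pcompose (indicial V v0) [:of_int w0, 1:]) (of_nat x)"
    by (simp add: poly_pcompose add.commute)
qed

lemma falling_poly_independent:
  assumes "(\<Sum>i\<le>N. smult (c i) (falling_poly i)) = 0" "i \<le> N"
  shows "c i = 0"
  using assms
proof (induction N)
  case (Suc N)
  have low: "coeff (\<Sum>i\<le>N. smult (c i) (falling_poly i)) (Suc N) = 0"
    unfolding coeff_sum by (rule sum.neutral) (auto simp: coeff_eq_0)
  have "0 = coeff (\<Sum>i\<le>Suc N. smult (c i) (falling_poly i)) (Suc N)" unfolding Suc.prems(1) by simp
  also have "\<dots> = c (Suc N)" using low by (simp add: coeff_sum coeff_falling_poly_self)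
  finally have "c (Suc N) = 0" by simp
  moreover from this have "(\<Sum>i\<le>N. smult (c i) (falling_poly i)) = 0" using Suc.prems by simp
  ultimately show ?case using Suc by (cases "i = Suc N") auto
qed simp

lemma indicial_eq_0_iff: "indicial W w = 0 \<longleftrightarrow> (\<forall>i. coeff_int (coeff W i) (int i + w) = 0)"
proof
  assume 0: "indicial W w = 0"
  show "\<forall>i. coeff_int (coeff W i) (int i + w) = 0"
  proof
    fix i
    show "coeff_int (coeff W i) (int i + w) = 0"
    proof (cases "i \<le> degree W")
      case True
      then show ?thesis using falling_poly_independent[OF 0[unfolded indicial_def]] by blast
    next
      case False
      then show ?thesis by (simp add: coeff_eq_0 coeff_int_def)
    qed
  qed
qed (simp add: indicial_def)

lemma degree_indicial: "degree (indicial W w) \<le> degree W"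
  unfolding indicial_def by (rule degree_sum_le) (auto intro: order.trans[OF degree_smult_le])

lemma finite_weights: "finite {w. indicial W w \<noteq> 0}"
proof -
  have "{w. indicial W w \<noteq> 0} \<subseteq> (\<Union>i\<le>degree W. {- int i..int (degree (coeff W i))})"
  proof
    fix w assume "w \<in> {w. indicial W w \<noteq> 0}"
    then obtain i where i: "coeff_int (coeff W i) (int i + w) \<noteq> 0" by (auto simp: indicial_eq_0_iff)
    then have "i \<le> degree W" by (metis coeff_eq_0 coeff_int_eq_0 coeff_int_def coeff_0 not_le)
    moreover have "\<not> (int i + w < 0 \<or> int i + w > int (degree (coeff W i)))"
      using i coeff_int_eq_0 by metis
    ultimately show "w \<in> (\<Union>i\<le>degree W. {- int i..int (degree (coeff W i))})"
      by (auto intro!: bexI[of _ i])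
  qed
  then show ?thesis by (rule finite_subset) simp
qed

lemma weights_nonempty: "W \<noteq> 0 \<Longrightarrow> \<exists>w. indicial W w \<noteq> 0"
proof (rule exI, unfold indicial_eq_0_iff, rule notI)
  assume "W \<noteq> 0" and
    *: "\<forall>i. coeff_int (coeff W i) (int i + (int (degree (lead_coeff W)) - int (degree W))) = 0"
  from *[rule_format, of "degree W"] have "lead_coeff (lead_coeff W) = 0" by simp
  with \<open>W \<noteq> 0\<close> show False by simp
qed

text \<open>For \<open>s = 1\<close> the weight \<open>w0\<close> is the lowest one occurring in \<open>W\<close>, for \<open>s = -1\<close> the highest; the sign
allows finite points and infinity to be treated together.\<close>

definition extremal :: "int \<Rightarrow> complex poly poly \<Rightarrow> int \<Rightarrow> bool" where
  "extremal s W w0 \<longleftrightarrow> indicial W w0 \<noteq> 0 \<and> (\<forall>w. s * w < s * w0 \<longrightarrow> indicial W w = 0)"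

lemma extremal_exists:
  assumes "W \<noteq> 0"
  obtains w0 where "extremal s W w0"
proof -
  let ?S = "{w. indicial W w \<noteq> 0}"
  have "finite ?S" "?S \<noteq> {}" using finite_weights weights_nonempty[OF assms] by auto
  then obtain w0 where "is_arg_min (\<lambda>w. s * w) (\<lambda>w. w \<in> ?S) w0"
    using ex_is_arg_min_if_finite by blast
  then have "extremal s W w0" by (auto simp: is_arg_min_def extremal_def)
  then show ?thesis using that by blast
qed

lemma extremal_unique:
  assumes "extremal s W w" "extremal s W w'" "s \<noteq> 0"
  shows "w = w'"
proof -
  have "\<not> s * w < s * w'" "\<not> s * w' < s * w" using assms by (auto simp: extremal_def)
  then show ?thesis using assms(3) by (metis linorder_neqE mult_left_cancel)
qed

lemma extremal_comp:
  assumes comp: "\<And>f. act U f = act V (act W f)"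
    and V: "extremal s V v0" and W: "extremal s W w0" and s: "s \<noteq> 0"
  shows "extremal s U (v0 + w0) \<and> indicial U (v0 + w0) = indicial W w0 * pcompose (indicial V v0) [:of_int w0, 1:]"
proof -
  \<comment> \<open>Both weights are extremal, so no other pair with the same or a more extreme sum contributes.\<close>
  have *: "indicial V v = 0 \<or> indicial W w = 0" if "s * (v + w) \<le> s * (v0 + w0)" "w \<noteq> w0" for v w
  proof (rule ccontr)
    assume "\<not> (indicial V v = 0 \<or> indicial W w = 0)"
    then have le: "s * v0 \<le> s * v" "s * w0 \<le> s * w"
      using V W by (auto simp: extremal_def not_less[symmetric])
    then have "s * w = s * w0" using that(1) le unfolding distrib_left by linarith
    then show False using s that(2) by simp
  qed
  have eq: "indicial U (v0 + w0) = indicial W w0 * pcompose (indicial V v0) [:of_int w0, 1:]"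
    by (rule indicial_comp[OF comp]) (use * in auto)
  have "indicial U (v0 + w0) \<noteq> 0"
    unfolding eq using V W by (auto simp: extremal_def pcompose_eq_0_iff)
  moreover have "indicial U u = 0" if u: "s * u < s * (v0 + w0)" for u
  proof -
    have "indicial U ((u - w0) + w0) = indicial W w0 * pcompose (indicial V (u - w0)) [:of_int w0, 1:]"
      by (rule indicial_comp[OF comp]) (use * u in auto)
    moreover have "indicial V (u - w0) = 0"
      using V u by (auto simp: extremal_def algebra_simps)
    ultimately show ?thesis by simp
  qed
  ultimately show ?thesis using eq by (simp add: extremal_def)
qed

lemma indicial_pCons_0: "indicial [:q:] v = [:coeff_int q v:]"
  by (simp add: indicial_def)

text \<open>Extremal weights add up under composition, and the indicial polynomials multiply up to a translation.
The factor \<open>q\<close> only contributes a constant. An indicial polynomial has at most the order of its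
operator as degree, so if \<open>L\<close> attains this bound, then so do both factors: a right factor of an
operator with a regular singularity is again regular there.\<close>

lemma extremal_divides:
  assumes comp: "\<And>f. q * act L f = act V (act W f)"
    and nz: "q \<noteq> 0" "V \<noteq> 0" "W \<noteq> 0"
    and deg: "degree V + degree W = degree (indicial L u0)"
    and L: "extremal s L u0" and s: "s \<noteq> 0"
  obtains w0 where "extremal s W w0" "indicial W w0 dvd indicial L u0" "degree (indicial W w0) = degree W"
proof -
  have act_q: "act [:q:] f = q * f" for f by (simp add: act_def)
  obtain v0 where v0: "extremal s V v0" using extremal_exists nz by blast
  obtain w0 where w0: "extremal s W w0" using extremal_exists nz by blast
  obtain q0 where q0: "extremal s [:q:] q0" using extremal_exists[of "[:q:]"] nz by auto
  have "act (smult q L) f = act V (act W f)" for f using comp by (simp add: act_smult)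
  note 1 = extremal_comp[OF this v0 w0 s]
  have "act (smult q L) f = act [:q:] (act L f)" for f by (simp add: act_smult act_q)
  note 2 = extremal_comp[OF this q0 L s]
  have "q0 + u0 = v0 + w0" using extremal_unique 1 2 s by blast
  then have "indicial L u0 * pcompose (indicial [:q:] q0) [:of_int u0, 1:]
      = indicial W w0 * pcompose (indicial V v0) [:of_int w0, 1:]" using 1 2 by metis
  then have eq: "smult (coeff_int q q0) (indicial L u0)
      = indicial W w0 * pcompose (indicial V v0) [:of_int w0, 1:]"
    by (simp add: indicial_pCons_0 pcompose_const)
  have c: "coeff_int q q0 \<noteq> 0" using q0 by (simp add: extremal_def indicial_pCons_0)
  have "indicial W w0 dvd smult (coeff_int q q0) (indicial L u0)" unfolding eq by simp
  then have dvd: "indicial W w0 dvd indicial L u0" using c by (simp add: dvd_smult_iff)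
  have ne: "indicial W w0 \<noteq> 0" "pcompose (indicial V v0) [:of_int w0, 1:] \<noteq> 0"
    using v0 w0 by (auto simp: extremal_def pcompose_eq_0_iff)
  have "degree (indicial L u0) = degree (indicial W w0 * pcompose (indicial V v0) [:of_int w0, 1:])"
    using c by (metis eq degree_smult_eq)
  also have "\<dots> = degree (indicial W w0) + degree (indicial V v0)"
    using ne by (simp add: degree_mult_eq degree_pcompose)
  finally have "degree (indicial W w0) = degree W"
    using deg degree_indicial[of W w0] degree_indicial[of V v0] by linarith
  then show ?thesis using that w0 dvd by blast
qed

section \<open>Residues at finite points\<close>

text \<open>Moves \<open>a\<close> to the origin, where indicial polynomials are computed.\<close>

definition translate :: "complex \<Rightarrow> complex poly poly \<Rightarrow> complex poly poly" where
  "translate a W = map_poly (\<lambda>p. pcompose p [:a, 1:]) W"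

lemma coeff_translate: "coeff (translate a W) i = pcompose (coeff W i) [:a, 1:]"
  by (simp add: translate_def coeff_map_poly)

lemma degree_translate [simp]: "degree (translate a W) = degree W"
  unfolding translate_def by (rule degree_map_poly) (simp add: pcompose_eq_0_iff)

lemma translate_eq_0_iff [simp]: "translate a W = 0 \<longleftrightarrow> W = 0"
  unfolding poly_eq_iff[of _ 0] coeff_translate by (simp add: pcompose_eq_0_iff)

lemma pcompose_translate_inverse: "pcompose (pcompose f [:- a, 1:]) [:a, 1:] = (f :: complex poly)"
proof -
  have "pcompose [:- a, 1:] [:a, 1:] = [:0, 1:]" by (simp add: pcompose_pCons)
  then show ?thesis by (simp only: pcompose_assoc[symmetric] pcompose_idR)
qed

lemma higher_pderiv_translate:
  "(pderiv ^^ i) (pcompose f [:a, 1:]) = pcompose ((pderiv ^^ i) f) [:a, 1::complex:]"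
  by (induction i) (simp_all add: pderiv_pcompose pderiv_pCons)

lemma act_translate: "act (translate a W) (pcompose f [:a, 1:]) = pcompose (act W f) [:a, 1:]"
  by (simp only: act_def degree_translate coeff_translate higher_pderiv_translate pcompose_sum pcompose_mult)

lemma act_translate_comp:
  assumes "\<And>f. q * act L f = act V (act W f)"
  shows "pcompose q [:a, 1:] * act (translate a L) f = act (translate a V) (act (translate a W) f)"
proof -
  define g where "g = pcompose f [:- a, 1:]"
  have f: "f = pcompose g [:a, 1:]" by (simp only: g_def pcompose_translate_inverse)
  show ?thesis unfolding f act_translate by (simp add: assms flip: pcompose_mult)
qed

lemma coeff_translate_0: "coeff (pcompose p [:a, 1:]) 0 = poly p a"
  by (simp add: poly_0_coeff_0[symmetric] poly_pcompose)

lemma coeff_translate_1: "coeff (pcompose p [:a, 1:]) 1 = poly (pderiv p) (a::complex)"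
proof -
  have "coeff (pcompose p [:a, 1:]) 1 = coeff (pderiv (pcompose p [:a, 1:])) 0"
    by (simp add: coeff_pderiv)
  also have "\<dots> = coeff (pcompose (pderiv p) [:a, 1:]) 0"
    by (simp add: pderiv_pcompose pderiv_pCons)
  finally show ?thesis by (simp add: coeff_translate_0)
qed

lemma pcompose_power: "pcompose (p ^ d) q = pcompose p q ^ d"
  by (induction d) (simp_all add: pcompose_mult)

lemma taylor_factor:
  fixes p :: "complex poly"
  assumes "\<And>e. e < d \<Longrightarrow> coeff (pcompose p [:a, 1:]) e = 0"
  obtains h where "p = [:- a, 1:] ^ d * h" "poly h a = coeff (pcompose p [:a, 1:]) d"
proof -
  have "monom 1 d dvd pcompose p [:a, 1:]" using assms by (simp add: monom_1_dvd_iff')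
  then obtain h where h: "pcompose p [:a, 1:] = monom 1 d * h" by (rule dvdE)
  have x: "pcompose [:0, 1:] [:- a, 1:] = [:- a, 1:]" by (simp add: pcompose_pCons)
  have "p = pcompose (pcompose p [:a, 1:]) [:- a, 1:]" using pcompose_translate_inverse[of p "- a"] by simp
  also have "\<dots> = [:- a, 1:] ^ d * pcompose h [:- a, 1:]"
    by (simp only: h pcompose_mult monom_altdef smult_1_left pcompose_power x)
  finally have "p = [:- a, 1:] ^ d * pcompose h [:- a, 1:]" .
  moreover have "poly (pcompose h [:- a, 1:]) a = coeff (pcompose p [:a, 1:]) d"
    by (simp only: poly_pcompose h coeff_monom_mult) (simp add: poly_0_coeff_0)
  ultimately show ?thesis using that by blast
qed

text \<open>\<open>v/u\<close> has at most a simple pole at \<open>a\<close>, with residue \<open>r\<close>, expressed through Taylor coefficients so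
that common zeros of \<open>u\<close> and \<open>v\<close> need not be cancelled. If \<open>u\<close> does not vanish at \<open>a\<close>, then \<open>d = 0\<close>, and
\<open>coeff_int\<close> at \<open>-1\<close> is \<open>0\<close>, which forces \<open>r = 0\<close>.\<close>

definition has_residue :: "complex poly \<Rightarrow> complex poly \<Rightarrow> complex \<Rightarrow> complex \<Rightarrow> bool" where
  "has_residue u v a r \<longleftrightarrow> (\<exists>d.
     (\<forall>e<d. coeff (pcompose u [:a, 1:]) e = 0) \<and> coeff (pcompose u [:a, 1:]) d \<noteq> 0 \<and>
     (\<forall>e. Suc e < d \<longrightarrow> coeff (pcompose v [:a, 1:]) e = 0) \<and>
     coeff_int (pcompose v [:a, 1:]) (int d - 1) = r * coeff (pcompose u [:a, 1:]) d)"

lemma has_residue_root: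
  assumes res: "has_residue u v a r" and root: "poly u a = 0" and u: "u \<noteq> 0"
  obtains h g where "u = [:- a, 1:] ^ order a u * h" "v = [:- a, 1:] ^ (order a u - 1) * g"
    "poly h a \<noteq> 0" "poly g a = r * poly h a" "order a u > 0"
proof -
  let ?u = "pcompose u [:a, 1:]" and ?v = "pcompose v [:a, 1:]"
  from res obtain d where d: "\<And>e. e < d \<Longrightarrow> coeff ?u e = 0" "coeff ?u d \<noteq> 0"
    "\<And>e. Suc e < d \<Longrightarrow> coeff ?v e = 0" "coeff_int ?v (int d - 1) = r * coeff ?u d"
    unfolding has_residue_def by blast
  have "d \<noteq> 0" using d(2) root by (metis coeff_translate_0)
  obtain h where h: "u = [:- a, 1:] ^ d * h" "poly h a = coeff ?u d"
    using taylor_factor[of d u a] d(1) by blast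
  obtain g where g: "v = [:- a, 1:] ^ (d - 1) * g" "poly g a = coeff ?v (d - 1)"
    using taylor_factor[of "d - 1" v a] d(3) by (metis less_diff_conv Suc_eq_plus1)
  have "order a u = order a ([:- a, 1:] ^ d) + order a h" using u unfolding h(1) by (rule order_mult)
  also have "order a h = 0" using h(2) d(2) by (intro order_0I) simp
  also have "order a ([:- a, 1:] ^ d) = d" by (rule order_power_n_n)
  finally have ord: "order a u = d" by simp
  have "int d - 1 = int (d - 1)" using \<open>d \<noteq> 0\<close> by simp
  then have "poly g a = r * poly h a" using d(4) g(2) h(2) by (simp only: coeff_int)
  with that show ?thesis using h g d(2) \<open>d \<noteq> 0\<close> unfolding ord by auto
qed

lemma coprime_linear:
  assumes "a \<noteq> b"
  shows "Rings.coprime [:- a, 1:] [:- b, 1::complex:]"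
proof (rule Rings.coprimeI)
  fix c assume "c dvd [:- a, 1:]" "c dvd [:- b, 1:]"
  then have "c dvd [:- a, 1:] - [:- b, 1:]" by (rule dvd_diff)
  then have "c dvd [:b - a:]" by simp
  then show "is_unit c" using assms by (metis dvd_trans is_unit_triv right_minus_eq)
qed

lemma prod_coprime_dvd:
  fixes f :: "'a \<Rightarrow> complex poly"
  assumes "finite S" "\<And>a. a \<in> S \<Longrightarrow> f a dvd v"
    "\<And>a b. a \<in> S \<Longrightarrow> b \<in> S \<Longrightarrow> a \<noteq> b \<Longrightarrow> Rings.coprime (f a) (f b)"
  shows "prod f S dvd v"
  using assms
proof (induction S rule: finite_induct)
  case (insert x S)
  have "Rings.coprime (f x) (prod f S)"
    by (intro prod_coprime_right) (use insert in auto)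
  then show ?case using insert by (simp add: divides_mult)
qed simp

text \<open>The residue theorem for \<open>v/u\<close>, whose residue at infinity is the negative quotient of the two
coefficients. After removing the common factor \<open>g\<close> the denominator has simple roots, and Lagrange
interpolation there expresses \<open>v\<close> through the residues.\<close>

lemma sum_of_residues:
  fixes u v :: "complex poly"
  assumes deg: "degree v < degree u" and res: "\<And>a. has_residue u v a (R a)"
  shows "coeff v (degree u - 1) = lead_coeff u * (\<Sum>a | poly u a = 0. R a)"
proof -
  have u: "u \<noteq> 0" using deg by auto
  define S where "S = {a. poly u a = 0}"
  have fin: "finite S" unfolding S_def using u by (rule poly_roots_finite)
  define c where "c = lead_coeff u"
  have c: "c \<noteq> 0" using u by (simp add: c_def)
  define g where "g = (\<Prod>a\<in>S. [:- a, 1:] ^ (order a u - 1))"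
  \<comment> \<open>Up to normalization, the Lagrange basis polynomials for the nodes \<open>S\<close>.\<close>
  define P where "P a = (\<Prod>b\<in>S - {a}. [:- b, 1:])" for a
  define G where "G a = (\<Prod>b\<in>S - {a}. [:- b, 1:] ^ (order b u - 1))" for a
  have ord: "order a u > 0" if "a \<in> S" for a
    using that u order_root unfolding S_def by auto
  have "u = smult c (\<Prod>a\<in>S. [:- a, 1:] ^ order a u)"
    unfolding c_def S_def using complex_poly_decompose[of u] by simp
  also have "(\<Prod>a\<in>S. [:- a, 1:] ^ order a u) = (\<Prod>a\<in>S. [:- a, 1:] ^ (order a u - 1) * [:- a, 1:])"
    by (intro prod.cong refl) (metis ord power_minus_mult)
  also have "\<dots> = g * (\<Prod>a\<in>S. [:- a, 1:])" by (simp only: g_def prod.distrib)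
  finally have u_eq: "u = smult c (g * (\<Prod>a\<in>S. [:- a, 1:]))" .
  have g_nz: "g \<noteq> 0" using fin by (simp add: g_def)
  have degP: "degree (\<Prod>a\<in>S. [:- a, 1:]) = card S"
    by (subst degree_prod_eq_sum_degree) auto
  have degu: "degree u = degree g + card S"
    using c g_nz fin degP by (simp add: u_eq degree_mult_eq)
  have u_P: "u = smult c (g * ([:- a, 1:] * P a))" if "a \<in> S" for a
    unfolding u_eq P_def using prod.remove[OF fin that, of "\<lambda>b. [:- b, 1:]"] by simp
  have g_G: "g = [:- a, 1:] ^ (order a u - 1) * G a" if "a \<in> S" for a
    unfolding g_def G_def using prod.remove[OF fin that] by simp
  have nzG: "poly (G a) a \<noteq> 0" for a using fin by (auto simp: G_def poly_prod)
  have "g dvd v" unfolding g_def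
  proof (rule prod_coprime_dvd[OF fin])
    fix a assume "a \<in> S"
    then show "[:- a, 1:] ^ (order a u - 1) dvd v"
      using has_residue_root[OF res _ u, of a] unfolding S_def by (metis dvd_triv_left mem_Collect_eq)
  next
    fix a b :: complex assume "a \<noteq> b"
    then have "Rings.coprime [:- a, 1:] [:- b, 1:]"
      by (rule coprime_linear)
    then show "Rings.coprime ([:- a, 1:] ^ (order a u - 1)) ([:- b, 1:] ^ (order b u - 1))" by simp
  qed
  then obtain v1 where v1: "v = g * v1" by (rule dvdE)
  have v1_val: "poly v1 a = c * R a * poly (P a) a" if a: "a \<in> S" for a
  proof -
    let ?x = "[:- a, 1:]"
    from a obtain h k where h: "u = ?x ^ order a u * h" "v = ?x ^ (order a u - 1) * k"
      "poly k a = R a * poly h a"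
      using has_residue_root[OF res _ u, of a] unfolding S_def by blast
    have x: "?x ^ m \<noteq> 0" for m by simp
    have "?x ^ order a u = ?x ^ (order a u - 1) * ?x" by (metis ord[OF a] power_minus_mult)
    then have "?x ^ order a u * h = ?x ^ order a u * smult c (G a * P a)"
      using h(1) u_P[OF a] g_G[OF a] by (metis (no_types, lifting) mult.assoc mult.left_commute mult_smult_right)
    then have h': "h = smult c (G a * P a)" using x by (metis mult_left_cancel)
    have "?x ^ (order a u - 1) * k = ?x ^ (order a u - 1) * (G a * v1)"
      using h(2) v1 g_G[OF a] by (metis mult.assoc)
    then have "k = G a * v1" using x by (metis mult_left_cancel)
    with h(3) h' have "poly (G a) a * poly v1 a = poly (G a) a * (c * R a * poly (P a) a)"
      by (simp add: mult_ac)
    then show ?thesis using nzG[of a] by simp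
  qed
  define H where "H = (\<Sum>a\<in>S. smult (c * R a) (P a))"
  have "v1 = H"
  proof (rule ccontr)
    assume ne: "v1 \<noteq> H"
    have "S \<subseteq> {z. poly (v1 - H) z = 0}"
    proof
      fix b assume b: "b \<in> S"
      have "poly H b = (\<Sum>a\<in>S. if a = b then c * R b * poly (P b) b else 0)"
        unfolding H_def poly_sum
      proof (rule sum.cong[OF refl])
        fix a assume "a \<in> S"
        show "poly (smult (c * R a) (P a)) b = (if a = b then c * R b * poly (P b) b else 0)"
        proof (cases "a = b")
          case False
          then have "poly (P a) b = 0" using b fin by (auto simp: P_def poly_prod)
          then show ?thesis using False by simp
        qed simp
      qed
      also have "\<dots> = poly v1 b" using b fin by (simp add: v1_val)
      finally show "b \<in> {z. poly (v1 - H) z = 0}" by simp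
    qed
    then have "card S \<le> card {z. poly (v1 - H) z = 0}"
      using ne by (intro card_mono poly_roots_finite) auto
    also have "\<dots> \<le> degree (v1 - H)" using ne by (intro poly_roots_degree) simp
    finally have le: "card S \<le> degree (v1 - H)" .
    have S: "card S > 0" using deg degu by (metis ne H_def card_gt_0_iff fin sum.empty v1 g_nz add_0_right card.empty degree_mult_eq le_add1 not_le)
    have "degree v1 < card S"
    proof (cases "v1 = 0")
      case False
      then show ?thesis using deg degu g_nz by (simp add: v1 degree_mult_eq)
    qed (use S in simp)
    moreover have "degree H < card S" unfolding H_def
    proof (rule degree_sum_less)
      fix a assume "a \<in> S"
      then have "degree (P a) = card S - 1"
        unfolding P_def using fin by (subst degree_prod_eq_sum_degree) auto
      then show "degree (smult (c * R a) (P a)) < card S" 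
        using S degree_smult_le[of "c * R a" "P a"] by linarith
    qed (use S in simp)
    ultimately have "degree (v1 - H) < card S" by (rule degree_diff_less)
    with le show False by simp
  qed
  then have "v = (\<Sum>a\<in>S. smult (c * R a) (g * P a))"
    by (simp add: v1 H_def sum_distrib_left)
  moreover have "coeff (g * P a) (degree u - 1) = 1" if a: "a \<in> S" for a
  proof -
    have nz: "g * P a \<noteq> 0" using g_nz fin by (simp add: P_def)
    have eq: "u = smult c ((g * P a) * [:- a, 1:])" using u_P[OF a] by (simp only: mult_ac)
    have "degree u = Suc (degree (g * P a))"
      unfolding eq using nz c by (simp only: degree_smult_eq) (subst degree_mult_eq, auto)
    moreover have "lead_coeff u = c * lead_coeff (g * P a)"
      unfolding eq by (simp only: lead_coeff_smult lead_coeff_mult) simp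
    ultimately show ?thesis using c by (simp add: c_def)
  qed
  ultimately have "coeff v (degree u - 1) = (\<Sum>a\<in>S. c * R a)"
    by (simp add: coeff_sum)
  then show ?thesis by (simp add: c_def S_def sum_distrib_left)
qed

text \<open>\<open>\<alpha>\<close> and \<open>\<gamma>\<close> are the leading Taylor coefficients of the two highest coefficients of \<open>W\<close>, so that \<open>\<gamma>/\<alpha>\<close>
is a residue of their quotient; the falling factorial of degree \<open>k\<close> contributes the sum
\<open>0 + \<dots> + (k - 1)\<close>.\<close>

lemma rootsum_indicial:
  assumes deg: "degree (indicial W w) = degree W" and pos: "degree W > 0"
  defines "k \<equiv> degree W"
  defines "\<alpha> \<equiv> coeff_int (coeff W k) (int k + w)"
    and "\<gamma> \<equiv> coeff_int (coeff W (k - 1)) (int k - 1 + w)"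
  shows "\<alpha> \<noteq> 0" "rootsum (indicial W w) = of_nat k * (of_nat k - 1) / 2 - \<gamma> / \<alpha>"
proof -
  obtain m where m: "k = Suc m" using pos by (cases k) (auto simp: k_def)
  define low where "low = (\<Sum>i<m. smult (coeff_int (coeff W i) (int i + w)) (falling_poly i))"
  have lowc: "coeff low j = 0" if "j \<ge> m" for j
    unfolding low_def coeff_sum using that by (intro sum.neutral) (auto simp: coeff_eq_0)
  have eq: "indicial W w = low + smult \<gamma> (falling_poly m) + smult \<alpha> (falling_poly (Suc m))"
    using m by (simp add: indicial_def low_def \<alpha>_def \<gamma>_def lessThan_Suc_atMost[symmetric] flip: k_def)
  have c1: "coeff (indicial W w) (Suc m) = \<alpha>"
    by (simp add: eq lowc coeff_falling_poly_self coeff_eq_0)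
  have c0: "coeff (indicial W w) m = \<gamma> + \<alpha> * coeff (falling_poly (Suc m)) m"
    by (simp add: eq lowc coeff_falling_poly_self)
  have "indicial W w \<noteq> 0" using deg pos by auto
  then show "\<alpha> \<noteq> 0" using c1 deg m by (metis k_def leading_coeff_0_iff)
  moreover have "- coeff (falling_poly (Suc m)) m = of_nat k * (of_nat k - 1) / 2"
    using rootsum_falling_poly[of "Suc m"] by (simp add: rootsum_def coeff_falling_poly_self m)
  then have "coeff (falling_poly (Suc m)) m = - (of_nat k * (of_nat k - 1) / 2)" by (metis minus_minus)
  moreover have "rootsum (indicial W w) = - coeff (indicial W w) m / \<alpha>"
    using deg c1 m by (simp add: rootsum_def flip: k_def)
  ultimately show "rootsum (indicial W w) = of_nat k * (of_nat k - 1) / 2 - \<gamma> / \<alpha>"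
    by (simp add: c0 add_divide_distrib diff_divide_distrib)
qed

lemma extremal_has_residue:
  assumes ext: "extremal 1 (translate a W) w" and deg: "degree (indicial (translate a W) w) = degree W"
    and pos: "degree W > 0"
  defines "k \<equiv> degree W"
  obtains r where "has_residue (coeff W k) (coeff W (k - 1)) a r"
    "rootsum (indicial (translate a W) w) = of_nat k * (of_nat k - 1) / 2 - r"
proof -
  let ?u = "pcompose (coeff W k) [:a, 1:]" and ?v = "pcompose (coeff W (k - 1)) [:a, 1:]"
  define \<alpha> \<gamma> where "\<alpha> = coeff_int ?u (int k + w)" and "\<gamma> = coeff_int ?v (int k - 1 + w)"
  have \<alpha>: "\<alpha> \<noteq> 0" and rs: "rootsum (indicial (translate a W) w) = of_nat k * (of_nat k - 1) / 2 - \<gamma> / \<alpha>"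
    using rootsum_indicial[of "translate a W" w] deg pos by (simp_all add: \<alpha>_def \<gamma>_def coeff_translate k_def)
  have "\<not> int k + w < 0" using \<alpha> by (auto simp: \<alpha>_def coeff_int_def)
  then obtain d where d: "int d = int k + w" by (metis not_less zero_le_imp_eq_int)
  have low: "coeff (pcompose (coeff W i) [:a, 1:]) e = 0" if "int e < int i + w" for i e
  proof -
    have "indicial (translate a W) (int e - int i) = 0" using ext that by (auto simp: extremal_def)
    then have "coeff_int (coeff (translate a W) i) (int i + (int e - int i)) = 0"
      unfolding indicial_eq_0_iff by blast
    then show ?thesis by (simp add: coeff_translate)
  qed
  have "has_residue (coeff W k) (coeff W (k - 1)) a (\<gamma> / \<alpha>)"
    unfolding has_residue_def
  proof (intro exI[of _ d] conjI allI impI)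
    fix e assume "e < d"
    then show "coeff ?u e = 0" using d by (intro low) simp
  next
    fix e assume "Suc e < d"
    then show "coeff ?v e = 0" using d pos by (intro low) (simp add: k_def of_nat_diff)
  next
    have \<alpha>d: "coeff ?u d = \<alpha>" unfolding \<alpha>_def d[symmetric] by simp
    then show "coeff ?u d \<noteq> 0" using \<alpha> by simp
    have d1: "int d - 1 = int k - 1 + w" using d by simp
    then show "coeff_int ?v (int d - 1) = \<gamma> / \<alpha> * coeff ?u d"
      unfolding \<gamma>_def \<alpha>d d1 using \<alpha> by simp
  qed
  with rs that show ?thesis by blast
qed

section \<open>Exponents and residues of a right factor\<close>

text \<open>The exponents at a regular point are \<open>0, 1, \<dots>, degree W - 1\<close>.\<close>

lemma extremal_indicial_regular:
  assumes c: "coeff (coeff W (degree W)) 0 \<noteq> 0"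
  shows "extremal 1 W (- int (degree W))"
    "indicial W (- int (degree W)) = smult (coeff (coeff W (degree W)) 0) (falling_poly (degree W))"
proof -
  let ?n = "degree W"
  have "indicial W (- int ?n) = (\<Sum>i\<le>?n. if i = ?n then smult (coeff (coeff W ?n) 0) (falling_poly ?n) else 0)"
    unfolding indicial_def by (intro sum.cong refl) (auto simp: coeff_int_def)
  then show eq: "indicial W (- int ?n) = smult (coeff (coeff W ?n) 0) (falling_poly ?n)" by simp
  have "indicial W w = 0" if "w < - int ?n" for w
    unfolding indicial_def by (rule sum.neutral) (use that in \<open>auto simp: coeff_int_def\<close>)
  then show "extremal 1 W (- int ?n)" using c by (simp add: extremal_def eq)
qed

text \<open>At a simple zero of the leading coefficient all exponents except one are \<open>0, 1, \<dots>\<close>, and the last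
one is determined by the next coefficient.\<close>

lemma extremal_indicial_simple:
  assumes deg: "degree W = Suc m"
    and c0: "coeff (coeff W (Suc m)) 0 = 0" and c1: "coeff (coeff W (Suc m)) 1 = c" "c \<noteq> 0"
    and sub: "coeff (coeff W m) 0 = (of_nat m - r) * c"
  shows "extremal 1 W (- int m)" "indicial W (- int m) = smult c (falling_poly m * [:- r, 1:])"
proof -
  have "indicial W (- int m) = (\<Sum>i<m. smult (coeff_int (coeff W i) (int i - int m)) (falling_poly i))
      + smult ((of_nat m - r) * c) (falling_poly m) + smult c (falling_poly (Suc m))"
    by (simp add: indicial_def deg sub c1[symmetric] lessThan_Suc_atMost[symmetric] coeff_int_def)
  also have "(\<Sum>i<m. smult (coeff_int (coeff W i) (int i - int m)) (falling_poly i)) = 0"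
    by (rule sum.neutral) (auto simp: coeff_int_def)
  also have "0 + smult ((of_nat m - r) * c) (falling_poly m) + smult c (falling_poly (Suc m))
      = smult c (falling_poly m * ([:of_nat m - r:] + [:- of_nat m, 1:]))"
    by (simp add: poly_eq_iff falling_poly_Suc algebra_simps)
  finally show eq: "indicial W (- int m) = smult c (falling_poly m * [:- r, 1:])" by simp
  have "indicial W w = 0" if w: "w < - int m" for w
    unfolding indicial_def deg
  proof (rule sum.neutral, rule ballI)
    fix i assume i: "i \<in> {..Suc m}"
    show "smult (coeff_int (coeff W i) (int i + w)) (falling_poly i) = 0"
    proof (cases "int i + w < 0")
      case False
      then have "i = Suc m" "int i + w = 0" using i w by auto
      then show ?thesis using c0 by simp
    qed (simp add: coeff_int_def)
  qed
  then show "extremal 1 W (- int m)" using c1 by (simp add: extremal_def eq del: mult_pCons_right)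
qed

text \<open>The indicial polynomial of the right factor \<open>W\<close> at \<open>a\<close> picks \<open>k\<close> exponents of \<open>L\<close>, and the residue is
\<open>k(k - 1)/2\<close> minus their sum. Where \<open>\<chi>\<close> does not vanish they are distinct natural numbers. At a root of \<open>\<chi>\<close> these are
\<open>0, \<dots>, n - 2, (n - 2)/2\<close>; the sum of \<open>k\<close> of them is at least \<open>0 + \<dots> + (k - 1)\<close>, lowered by
\<open>k - 1 - (n - 2)/2 = k - n/2\<close> if this is positive.\<close>

lemma residue_bound:
  fixes L V W :: "complex poly poly"
  assumes comp: "\<And>f. q * act L f = act V (act W f)"
    and nz: "q \<noteq> 0" "V \<noteq> 0" "W \<noteq> 0"
    and n: "degree L = n" "degree V + degree W = n" and k: "degree W = k" "k > 0"
    and \<chi>: "coeff L n = \<chi>" and simple: "poly \<chi> a = 0 \<Longrightarrow> poly (pderiv \<chi>) a \<noteq> 0"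
    and sub: "coeff L (n - 1) = smult (of_nat n / 2) (pderiv \<chi>)"
  shows "\<exists>r. has_residue (coeff W k) (coeff W (k - 1)) a r \<and>
    Re r \<le> (if poly \<chi> a = 0 then max 0 (real k - real n / 2) else 0)"
proof -
  have nz': "pcompose q [:a, 1:] \<noteq> 0" "translate a V \<noteq> 0" "translate a W \<noteq> 0"
    using nz by (simp_all add: pcompose_eq_0_iff)
  have main: "\<exists>r. has_residue (coeff W k) (coeff W (k - 1)) a r \<and> Re r \<le> B"
    if ext: "extremal 1 (translate a L) u0" and ind: "indicial (translate a L) u0 = smult c p" "c \<noteq> 0" "degree p = n"
      and bound: "\<And>q. q dvd p \<Longrightarrow> degree q = k \<Longrightarrow>
        Re (rootsum q) \<ge> real k * (real k - 1) / 2 - B" for u0 c p B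
  proof -
    have "degree (translate a V) + degree (translate a W) = degree (indicial (translate a L) u0)"
      using n ind by simp
    then obtain w0 where w0: "extremal 1 (translate a W) w0" "indicial (translate a W) w0 dvd indicial (translate a L) u0"
      "degree (indicial (translate a W) w0) = degree (translate a W)"
      using extremal_divides[OF act_translate_comp[OF comp] nz' _ ext] by auto
    obtain r where r: "has_residue (coeff W k) (coeff W (k - 1)) a r"
      "rootsum (indicial (translate a W) w0) = of_nat k * (of_nat k - 1) / 2 - r"
      using extremal_has_residue[of a W w0] w0 k by auto
    have "indicial (translate a W) w0 dvd p" using w0(2) ind by (simp add: dvd_smult_iff)
    then have "Re (rootsum (indicial (translate a W) w0)) \<ge> real k * (real k - 1) / 2 - B"
      using w0(3) k by (intro bound) auto
    moreover have "Re (rootsum (indicial (translate a W) w0)) = real k * (real k - 1) / 2 - Re r"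
      unfolding r(2) by simp
    ultimately show ?thesis using r(1) by auto
  qed
  show ?thesis
  proof (cases "poly \<chi> a = 0")
    case False
    have c: "coeff (coeff (translate a L) (degree (translate a L))) 0 = poly \<chi> a"
      using n \<chi> by (simp add: coeff_translate coeff_translate_0)
    have "\<exists>r. has_residue (coeff W k) (coeff W (k - 1)) a r \<and> Re r \<le> 0"
    proof (rule main[of "- int n" "poly \<chi> a" "falling_poly n"])
      show "extremal 1 (translate a L) (- int n)" "indicial (translate a L) (- int n) = smult (poly \<chi> a) (falling_poly n)"
        using extremal_indicial_regular[of "translate a L"] c False n(1) by simp_all
      fix q assume "q dvd falling_poly n" "degree q = k"
      then show "real k * (real k - 1) / 2 - 0 \<le> Re (rootsum q)" using rootsum_dvd_falling_poly[of q n] by simp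
    qed (use False in auto)
    then show ?thesis using False by simp
  next
    case True
    obtain m where m: "n = Suc m" using n k by (cases n) auto
    define c where "c = poly (pderiv \<chi>) a"
    \<comment> \<open>The exponent at \<open>a\<close> besides \<open>0, \<dots>, n - 2\<close>.\<close>
    define \<rho> where "\<rho> = (real n - 2) / 2"
    have c0: "c \<noteq> 0" using simple True by (simp add: c_def)
    have dL: "degree (translate a L) = Suc m" using n m by simp
    have e0: "coeff (coeff (translate a L) (Suc m)) 0 = 0"
      using \<chi> True m by (simp add: coeff_translate coeff_translate_0)
    have e1: "coeff (coeff (translate a L) (Suc m)) 1 = c"
      using \<chi> m unfolding coeff_translate coeff_translate_1 c_def by simp
    have "coeff (coeff (translate a L) m) 0 = of_nat n / 2 * c"
      using sub m by (simp add: coeff_translate coeff_translate_0 c_def)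
    also have "of_nat n / 2 = of_nat m - complex_of_real \<rho>"
      by (simp add: \<rho>_def m field_simps)
    finally have es: "coeff (coeff (translate a L) m) 0 = (of_nat m - complex_of_real \<rho>) * c" .
    note ei = extremal_indicial_simple[OF dL e0 e1 c0 es]
    have "\<exists>r. has_residue (coeff W k) (coeff W (k - 1)) a r \<and> Re r \<le> max 0 (real k - real n / 2)"
    proof (rule main[OF ei c0])
      have "degree (falling_poly m * [:- complex_of_real \<rho>, 1:]) = degree (falling_poly m) + degree [:- complex_of_real \<rho>, 1:]"
        by (rule degree_mult_eq) simp_all
      then show "degree (falling_poly m * [:- complex_of_real \<rho>, 1:]) = n" unfolding m by simp
      fix q assume "q dvd falling_poly m * [:- complex_of_real \<rho>, 1:]" "degree q = k"
      then have "Re (rootsum q) \<ge> real k * (real k - 1) / 2 + min 0 (\<rho> - (real k - 1))"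
        using rootsum_dvd_falling_poly_linear[of q "Suc m" \<rho>] k by simp
      moreover have "min 0 (\<rho> - (real k - 1)) = - max 0 (real k - real n / 2)"
        by (simp add: \<rho>_def min_def max_def field_simps)
      ultimately show "real k * (real k - 1) / 2 - max 0 (real k - real n / 2) \<le> Re (rootsum q)" by simp
    qed
    then show ?thesis using True by simp
  qed
qed

text \<open>All exponents of the right factor at infinity are \<open>x = -1\<close>, which fixes the sum of its indicial
roots there as \<open>-k\<close>, and thereby the quotient of the leading coefficients of \<open>v\<close> and \<open>u\<close> as
\<open>k + k(k - 1)/2\<close>.\<close>

lemma residue_sum_at_infinity:
  assumes comp: "\<And>f. q * act L f = act V (act W f)"
    and nz: "q \<noteq> 0" "V \<noteq> 0" "W \<noteq> 0"
    and n: "degree V + degree W = n" and k: "degree W = k" "k > 0"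
    and inf: "indicial L 1 = [:1, 1:] ^ n" "\<And>w. w > 1 \<Longrightarrow> indicial L w = 0"
  shows "degree (coeff W (k - 1)) < degree (coeff W k)"
    and "coeff (coeff W (k - 1)) (degree (coeff W k) - 1)
      = of_nat k * (of_nat k + 1) / 2 * lead_coeff (coeff W k)"
proof -
  let ?u = "coeff W k" and ?v = "coeff W (k - 1)"
  have ext: "extremal (-1) L 1" using inf by (simp add: extremal_def)
  have dn: "degree V + degree W = degree (indicial L 1)" using n inf by (simp add: degree_power_eq)
  obtain w where w: "extremal (-1) W w" "indicial W w dvd indicial L 1" "degree (indicial W w) = degree W"
    using extremal_divides[OF comp nz dn ext] by auto
  define \<alpha> \<gamma> where "\<alpha> = coeff_int ?u (int k + w)" and "\<gamma> = coeff_int ?v (int k - 1 + w)"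
  have \<alpha>: "\<alpha> \<noteq> 0" and rs: "rootsum (indicial W w) = of_nat k * (of_nat k - 1) / 2 - \<gamma> / \<alpha>"
    using rootsum_indicial[of W w] w(3) k by (simp_all add: \<alpha>_def \<gamma>_def)
  have "rootsum (indicial W w) = - of_nat k"
    using rootsum_dvd_power[of "indicial W w" n] w inf k by simp
  then have "\<gamma> / \<alpha> = of_nat k * (of_nat k + 1) / 2" using rs by (simp add: algebra_simps add_divide_distrib diff_divide_distrib)
  then have \<gamma>: "\<gamma> = of_nat k * (of_nat k + 1) / 2 * \<alpha>" using \<alpha> by (simp add: field_simps)
  have "(of_nat k * (of_nat k + 1) :: complex) = of_nat (k * (k + 1))" by (simp add: algebra_simps)
  then have "(of_nat k * (of_nat k + 1) :: complex) \<noteq> 0" using k by (metis of_nat_eq_0_iff mult_is_0 add_is_0 zero_neq_one neq0_conv)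
  then have \<gamma>0: "\<gamma> \<noteq> 0" unfolding \<gamma> using \<alpha> by simp
  have "\<not> int k - 1 + w < 0" using \<gamma>0 by (auto simp: \<gamma>_def coeff_int_def)
  then obtain e where e: "int e = int k - 1 + w" by (metis not_less zero_le_imp_eq_int)
  have high: "coeff (coeff W i) j = 0" if "int j > int i + w" for i j
  proof -
    have "indicial W (int j - int i) = 0" using w(1) that by (auto simp: extremal_def)
    then have "coeff_int (coeff W i) (int i + (int j - int i)) = 0" unfolding indicial_eq_0_iff by blast
    then show ?thesis by simp
  qed
  have ue: "coeff ?u (Suc e) = \<alpha>" 
  proof -
    have "int k + w = int (Suc e)" using e by simp
    then show ?thesis unfolding \<alpha>_def by (simp only: coeff_int)
  qed
  have ve: "coeff ?v e = \<gamma>" unfolding \<gamma>_def e[symmetric] by simp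
  have "degree ?u \<le> Suc e" by (rule degree_le) (use e in \<open>auto intro!: high\<close>)
  moreover have "Suc e \<le> degree ?u" using ue \<alpha> by (intro le_degree) simp
  ultimately have du: "degree ?u = Suc e" by simp
  have "degree ?v \<le> e" by (rule degree_le) (use e k in \<open>auto intro!: high simp: of_nat_diff\<close>)
  then show "degree ?v < degree ?u" using du by simp
  show "coeff ?v (degree ?u - 1) = of_nat k * (of_nat k + 1) / 2 * lead_coeff ?u"
    unfolding du using ve ue \<gamma> by simp
qed

text \<open>The residues of \<open>v/u\<close> for a right factor \<open>u \<partial>\<^sup>k + v \<partial>\<^sup>k\<^sup>-\<^sup>1 + \<dots>\<close> would be too small at the finite points
for the sum that is prescribed at infinity.\<close>

theorem irreducibility_criterion:
  assumes n: "degree L = n"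
    and \<chi>: "coeff L n = \<chi>" "degree \<chi> = Suc n"
    and simple: "\<And>a. poly \<chi> a = 0 \<Longrightarrow> poly (pderiv \<chi>) a \<noteq> 0"
    and sub: "coeff L (n - 1) = smult (of_nat n / 2) (pderiv \<chi>)"
    and inf: "indicial L 1 = [:1, 1:] ^ n" "\<And>w. w > 1 \<Longrightarrow> indicial L w = 0"
  shows "op_irreducible (DiffOp (fract_poly L))"
  unfolding op_irreducible_def
proof
  assume "\<exists>L1 L2. DiffOp (fract_poly L) = L1 * L2 \<and> 0 < op_order L1 \<and> 0 < op_order L2"
  then obtain L1 L2 where fac: "DiffOp (fract_poly L) = L1 * L2" "0 < op_order L1" "0 < op_order L2"
    by blast
  have "\<chi> \<noteq> 0" using \<chi> by auto
  then have "L \<noteq> 0" using \<chi> by auto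
  from factorization_clear_denominators[OF fac(1) this]
  obtain q V W where q: "q \<noteq> 0" "smult q L = weyl_mult V W" "degree V = op_order L1"
    "degree W = op_order L2" "degree V + degree W = degree L" by blast
  define k where "k = degree W"
  have k: "degree W = k" "k > 0" "k < n" using q fac n by (auto simp: k_def)
  have nz: "q \<noteq> 0" "V \<noteq> 0" "W \<noteq> 0" using q fac by auto
  have comp: "q * act L f = act V (act W f)" for f
    using act_weyl_mult[of V W f] act_smult[of q L f] q(2) by simp
  have VW: "degree V + degree W = n" using q n by simp
  let ?u = "coeff W k" and ?v = "coeff W (k - 1)"
  define M where "M = max 0 (real k - real n / 2)"
  obtain R where R: "\<And>a. has_residue ?u ?v a (R a)"
    "\<And>a. Re (R a) \<le> (if poly \<chi> a = 0 then M else 0)"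
    using residue_bound[OF comp nz n VW k(1,2) \<chi>(1) simple sub] unfolding M_def by metis
  note infty = residue_sum_at_infinity[OF comp nz VW k(1,2) inf]
  have u: "?u \<noteq> 0" using infty(1) by auto
  have "lead_coeff ?u * (\<Sum>a | poly ?u a = 0. R a) = lead_coeff ?u * (of_nat k * (of_nat k + 1) / 2)"
    using sum_of_residues[OF infty(1) R(1)] infty(2) by (simp add: mult.commute)
  then have "(\<Sum>a | poly ?u a = 0. R a) = complex_of_real (real k * (real k + 1) / 2)"
    using u by simp
  then have "real k * (real k + 1) / 2 = Re (\<Sum>a | poly ?u a = 0. R a)"
    by (simp only: Re_complex_of_real)
  also have "\<dots> = (\<Sum>a | poly ?u a = 0. Re (R a))" by simp
  also have "\<dots> \<le> (\<Sum>a | poly ?u a = 0. if poly \<chi> a = 0 then M else 0)"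
    by (intro sum_mono R(2))
  also have "\<dots> = (\<Sum>a | poly ?u a = 0 \<and> poly \<chi> a = 0. M)"
    using poly_roots_finite[OF u] by (simp add: sum.If_cases Int_def conj_commute)
  also have "\<dots> = real (card {a. poly ?u a = 0 \<and> poly \<chi> a = 0}) * M" by simp
  also have "\<dots> \<le> real (Suc n) * M"
  proof (intro mult_right_mono)
    have "card {a. poly ?u a = 0 \<and> poly \<chi> a = 0} \<le> card {a. poly \<chi> a = 0}"
      using \<open>\<chi> \<noteq> 0\<close> by (intro card_mono poly_roots_finite) auto
    also have "\<dots> \<le> Suc n" using poly_roots_degree[OF \<open>\<chi> \<noteq> 0\<close>] \<chi> by simp
    finally show "real (card {a. poly ?u a = 0 \<and> poly \<chi> a = 0}) \<le> real (Suc n)" by simp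
  qed (simp add: M_def)
  finally have le: "real k * (real k + 1) / 2 \<le> real (Suc n) * M" .
  show False
  proof (cases "real k \<le> real n / 2")
    case True
    then have "M = 0" by (simp add: M_def)
    then show False using le k by (simp add: mult_le_0_iff)
  next
    case False
    then have M: "M = real k - real n / 2" by (simp add: M_def)
    have "real k * (real k + 1) \<le> (real n + 1) * (2 * real k - real n)"
      using le unfolding M by (simp add: field_simps)
    moreover have "(real n - real k) * (real n - real k + 1) =
      real k * (real k + 1) - (real n + 1) * (2 * real k - real n)" by (simp add: algebra_simps)
    moreover have "(real n - real k) * (real n - real k + 1) > 0" using k by simp
    ultimately show False by linarith
  qed
qed

section \<open>Operators of type DN with simple characteristic roots\<close>

definition DN_char_poly :: "nat \<Rightarrow> complex mat \<Rightarrow> complex poly" where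
  "DN_char_poly n A = hess (char_entry A) 0 (Suc n)"

text \<open>Dividing by \<open>\<partial>\<close> on the right turns the eigenvalue \<open>(x + 1)\<^sup>n\<^sup>+\<^sup>1\<close> of the determinant on the leading
term of \<open>t\<^sup>x\<^sup>+\<^sup>1\<close> into \<open>(x + 1)\<^sup>n\<close>, since \<open>\<partial> t\<^sup>x\<^sup>+\<^sup>1 = (x + 1) t\<^sup>x\<close>.\<close>

lemma indicial_weyl_hess:
  assumes Q: "weyl_hess (char_entry A) (Suc n) = pCons 0 L"
  shows "indicial L 1 = [:1, 1:] ^ n" "w > 1 \<Longrightarrow> indicial L w = 0"
proof -
  have act_L: "act L (smult (of_nat (Suc x)) (monom 1 x)) = act (pCons 0 L) (monom 1 (Suc x))" for x
    by (simp add: act_pCons_0 pderiv_monom smult_monom)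
  have c: "coeff (act L (monom 1 x)) j * of_nat (Suc x) =
      coeff (act (weyl_hess (char_entry A) (Suc n)) (monom 1 (Suc x))) j" for x j
    unfolding Q act_L[symmetric] act_smult_right by (simp add: mult.commute)
  show "indicial L 1 = [:1, 1:] ^ n"
  proof (rule poly_eq_of_large_nat[of 0])
    fix x :: nat
    have "int (Suc x) - int x = 1" by simp
    then have "poly (indicial L 1) (of_nat x) = coeff (act L (monom 1 x)) (Suc x)"
      by (simp only: coeff_act_monom)
    moreover have "coeff (act L (monom 1 x)) (Suc x) * of_nat (Suc x) = of_nat (Suc x) ^ Suc n"
      unfolding c using act_weyl_hess[of A "Suc n" "Suc x"] by simp
    moreover have "(of_nat (Suc x) :: complex) \<noteq> 0" by (simp del: of_nat_Suc)
    ultimately have "poly (indicial L 1) (of_nat x) = of_nat (Suc x) ^ n"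
      by (metis mult_right_cancel power_Suc2)
    then show "poly (indicial L 1) (of_nat x) = poly ([:1, 1:] ^ n) (of_nat x)"
      by (simp add: poly_power add.commute)
  qed
  show "indicial L w = 0" if w: "w > 1"
  proof (rule poly_eq_of_large_nat[of 0])
    fix x :: nat
    define j where "j = nat (int x + w)"
    have "j > Suc x" "int j - int x = w" using w by (auto simp: j_def)
    then have "coeff (act L (monom 1 x)) j * of_nat (Suc x) = 0"
      unfolding c using act_weyl_hess[of A "Suc n" "Suc x"] by (intro coeff_eq_0) simp
    moreover have "(of_nat (Suc x) :: complex) \<noteq> 0" by (simp del: of_nat_Suc)
    ultimately have "coeff (act L (monom 1 x)) j = 0" by (metis mult_eq_0_iff)
    then show "poly (indicial L w) (of_nat x) = poly 0 (of_nat x)"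
      using \<open>int j - int x = w\<close> by (simp add: coeff_act_monom)
  qed
qed

lemma char_entry_symmetric:
  assumes A: "A \<in> DN_params n" and "i \<le> j" "j \<le> n"
  shows "char_entry A i j = char_entry A (n - j) (n - i)"
proof -
  have "i \<le> n" using assms by simp
  then have "A $$ (i, j) = A $$ (n - j, n - i)" using A \<open>j \<le> n\<close> unfolding DN_params_def by blast
  moreover have "i = j \<longleftrightarrow> n - j = n - i" using assms by auto
  ultimately show ?thesis unfolding char_entry_def by metis
qed

theorem DN_op_irreducible:
  assumes A: "A \<in> DN_params n" and n: "n \<ge> 1"
    and simple: "\<And>a. poly (DN_char_poly n A) a = 0 \<Longrightarrow> poly (pderiv (DN_char_poly n A)) a \<noteq> 0"
  shows "op_irreducible (DN_op n A)"
proof -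
  let ?m = "char_entry A" and ?\<chi> = "DN_char_poly n A"
  obtain L where L: "DN_op n A = DiffOp (fract_poly L)" "weyl_hess ?m (Suc n) = pCons 0 L"
    using DN_op_poly[OF A] by blast
  have d: "degree ?\<chi> = Suc n" unfolding DN_char_poly_def using degree_hess_char_entry by blast
  define s where "s = (\<Sum>l<Suc n. of_nat (n - l) * (hess ?m 0 l * hess ?m (Suc l) (n - l)))"
  have "leading_pair (weyl_hess ?m (Suc n)) (Suc n) ?\<chi> s"
    using leading_pair_weyl_hess[of ?m "Suc n", OF pderiv_char_entry] by (simp only: DN_char_poly_def s_def diff_Suc_1)
  then have top: "degree (pCons 0 L) \<le> Suc n" "coeff L n = ?\<chi>" "coeff (pCons 0 L) n = s"
    by (simp_all add: leading_pair_def L(2) del: weyl_hess.simps)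
  have "pderiv ?\<chi> = (\<Sum>l<Suc n. hess ?m 0 l * hess ?m (Suc l) (n - l))"
    unfolding DN_char_poly_def using pderiv_hess[of ?m "Suc n", OF pderiv_char_entry]
    by (simp only: diff_Suc_1)
  then have "2 * s = of_nat n * pderiv ?\<chi>"
    using weighted_sum_symmetric[of n ?m, OF char_entry_symmetric[OF A]] by (simp only: s_def)
  then have "smult 2 s = smult (of_nat n) (pderiv ?\<chi>)"
    by (simp add: numeral_poly of_nat_poly)
  then have "s = smult (of_nat n / 2) (pderiv ?\<chi>)"
    by (metis (no_types, lifting) smult_smult divide_inverse mult.commute left_inverse smult_1_left zero_neq_numeral)
  then have sub: "coeff L (n - 1) = smult (of_nat n / 2) (pderiv ?\<chi>)"
    using top(3) n by (cases n) auto
  have "?\<chi> \<noteq> 0" using d by auto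
  then have "L \<noteq> 0" "n \<le> degree L" using top(2) by (auto intro: le_degree)
  then have dL: "degree L = n" using top(1) by simp
  show ?thesis unfolding L(1)
    by (rule irreducibility_criterion[OF dL top(2) d simple sub indicial_weyl_hess[OF L(2)]])
qed


section \<open>Genericity\<close>

lemma DN_poly_funs_sum:
  "(\<And>x. x \<in> S \<Longrightarrow> f x \<in> DN_poly_funs n) \<Longrightarrow> (\<lambda>A. \<Sum>x\<in>S. f x A) \<in> DN_poly_funs n"
  by (induction S rule: infinite_finite_induct) (auto intro: DN_poly_funs.intros)

lemma DN_poly_funs_prod:
  "(\<And>x. x \<in> S \<Longrightarrow> f x \<in> DN_poly_funs n) \<Longrightarrow> (\<lambda>A. \<Prod>x\<in>S. f x A) \<in> DN_poly_funs n"
  by (induction S rule: infinite_finite_induct) (auto intro: DN_poly_funs.intros)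

lemma DN_poly_funs_uminus: "f \<in> DN_poly_funs n \<Longrightarrow> (\<lambda>A. - f A) \<in> DN_poly_funs n"
  using DN_poly_funs.mult[OF DN_poly_funs.const[of "-1"], of f n] by simp

lemma coeff_char_entry_poly_fun:
  assumes "i \<le> j" "j \<le> n"
  shows "(\<lambda>A. coeff (char_entry A i j) d) \<in> DN_poly_funs n"
proof -
  have "(\<lambda>A. coeff (char_entry A i j) d) =
     (if d = 0 then (\<lambda>A. - A $$ (i, j)) else (\<lambda>A. if d = 1 \<and> i = j then 1 else 0))"
    by (auto simp: char_entry_def fun_eq_iff coeff_pCons split: nat.splits)
  then show ?thesis
    using DN_poly_funs_uminus[OF DN_poly_funs.coord[OF assms]] DN_poly_funs.const by auto
qed

lemma coeff_hess_poly_fun: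
  "k \<le> Suc n \<Longrightarrow> (\<lambda>A. coeff (hess (char_entry A) 0 k) d) \<in> DN_poly_funs n"
proof (induction k arbitrary: d rule: less_induct)
  case (less k)
  show ?case
  proof (cases k)
    case 0
    then show ?thesis by (simp add: DN_poly_funs.const)
  next
    case (Suc k')
    have eq: "(\<lambda>A. coeff (hess (char_entry A) 0 k) d) = (\<lambda>A. \<Sum>i\<le>k'. \<Sum>e\<le>d.
        coeff (char_entry A i k') e * coeff (hess (char_entry A) 0 i) (d - e))"
      by (simp add: Suc coeff_sum coeff_mult)
    show ?thesis unfolding eq
      by (intro DN_poly_funs_sum DN_poly_funs.mult coeff_char_entry_poly_fun less.IH)
        (use less.prems Suc in auto)
  qed
qed

text \<open>The degrees of \<open>\<chi>\<close> and \<open>\<chi>'\<close> do not depend on \<open>A\<close>, hence neither does the size of the Sylvester matrix.\<close>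

lemma resultant_poly_fun:
  "(\<lambda>A. resultant (DN_char_poly n A) (pderiv (DN_char_poly n A))) \<in> DN_poly_funs n"
proof -
  let ?\<chi> = "DN_char_poly n"
  have d: "degree (?\<chi> A) = Suc n" "degree (pderiv (?\<chi> A)) = n" for A
    using degree_hess_char_entry[of A "Suc n"] by (simp_all add: DN_char_poly_def degree_pderiv del: hess.simps)
  have coeff: "(\<lambda>A. coeff (?\<chi> A) e) \<in> DN_poly_funs n" for e
    unfolding DN_char_poly_def by (rule coeff_hess_poly_fun) simp
  have coeff': "(\<lambda>A. coeff (pderiv (?\<chi> A)) e) \<in> DN_poly_funs n" for e
    unfolding coeff_pderiv by (intro DN_poly_funs.mult DN_poly_funs.const coeff)
  have entry: "(\<lambda>A. sylvester_mat (?\<chi> A) (pderiv (?\<chi> A)) $$ (i, j)) \<in> DN_poly_funs n"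
    if "i < Suc n + n" "j < Suc n + n" for i j
  proof -
    have "(\<lambda>A. sylvester_mat (?\<chi> A) (pderiv (?\<chi> A)) $$ (i, j)) =
      (if i < n then if i \<le> j \<and> j - i \<le> Suc n then (\<lambda>A. coeff (?\<chi> A) (Suc n + i - j)) else (\<lambda>A. 0)
       else if i - n \<le> j \<and> j \<le> i then (\<lambda>A. coeff (pderiv (?\<chi> A)) (i - j)) else (\<lambda>A. 0))"
      using that by (intro ext) (subst sylvester_index_mat, auto simp: d)
    then show ?thesis using coeff coeff' DN_poly_funs.const by auto
  qed
  have dim: "dim_row (sylvester_mat (?\<chi> A) (pderiv (?\<chi> A))) = Suc n + n"
    "dim_col (sylvester_mat (?\<chi> A) (pderiv (?\<chi> A))) = Suc n + n" for A
    by (simp_all add: d)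
  have "(\<lambda>A. resultant (?\<chi> A) (pderiv (?\<chi> A))) =
     (\<lambda>A. \<Sum>p | p permutes {0..<Suc n + n}. signof p *
        (\<Prod>i = 0..<Suc n + n. sylvester_mat (?\<chi> A) (pderiv (?\<chi> A)) $$ (i, p i)))"
    unfolding resultant_def det_def dim by simp
  moreover have "\<dots> \<in> DN_poly_funs n"
  proof (intro DN_poly_funs_sum DN_poly_funs.mult DN_poly_funs.const DN_poly_funs_prod entry)
    fix p i assume "p \<in> {p. p permutes {0..<Suc n + n}}" and i: "i \<in> {0..<Suc n + n}"
    then have "p permutes {0..<Suc n + n}" by simp
    then have "p i \<in> {0..<Suc n + n}" using i by (simp only: permutes_in_image)
    then show "i < Suc n + n" "p i < Suc n + n" using i by simp_all
  qed
  ultimately show ?thesis by simp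
qed

lemma resultant_pderiv_nonzero_iff:
  fixes p :: "complex poly"
  assumes "p \<noteq> 0"
  shows "resultant p (pderiv p) \<noteq> 0 \<longleftrightarrow> (\<forall>a. poly p a = 0 \<longrightarrow> poly (pderiv p) a \<noteq> 0)"
proof -
  let ?g = "gcd p (pderiv p)"
  have g: "?g \<noteq> 0" using assms by simp
  have "degree ?g \<noteq> 0 \<longleftrightarrow> (\<exists>a. poly ?g a = 0)"
  proof
    assume "degree ?g \<noteq> 0"
    then show "\<exists>a. poly ?g a = 0"
      using fundamental_theorem_of_algebra by (metis constant_degree)
  next
    assume "\<exists>a. poly ?g a = 0"
    then show "degree ?g \<noteq> 0" using g by (metis poly_const_conv degree_eq_zeroE pCons_0_0)
  qed
  moreover have "poly ?g a = 0 \<longleftrightarrow> poly p a = 0 \<and> poly (pderiv p) a = 0" for a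
    unfolding poly_eq_0_iff_dvd by (rule gcd_greatest_iff)
  ultimately show ?thesis unfolding resultant_0_gcd by blast
qed

text \<open>A point of the parameter space whose eigenvalues, the roots of unity of order \<open>n + 1\<close>, are distinct.\<close>

definition cyclic_mat :: "nat \<Rightarrow> complex mat" where
  "cyclic_mat n = mat (Suc n) (Suc n) (\<lambda>(i, j). if i = j + 1 \<or> i = 0 \<and> j = n then 1 else 0)"

lemma cyclic_mat_DN_params: "n \<ge> 1 \<Longrightarrow> cyclic_mat n \<in> DN_params n"
  by (auto simp: DN_params_def cyclic_mat_def)

lemma char_poly_cyclic_mat:
  assumes n: "n \<ge> 1"
  shows "DN_char_poly n (cyclic_mat n) = monom 1 (Suc n) - 1"
proof -
  let ?m = "char_entry (cyclic_mat n)"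
  have m: "?m i k = (if i = k then [:0, 1:] else if i = 0 \<and> k = n then [:-1:] else 0)"
    if "i \<le> k" "k \<le> n" for i k
    using that n by (auto simp: char_entry_def cyclic_mat_def)
  have low: "hess ?m 0 k = monom 1 k" if "k \<le> n" for k
    using that
  proof (induction k)
    case (Suc k)
    have "hess ?m 0 (Suc k) = (\<Sum>i\<le>k. if i = k then [:0, 1:] * hess ?m 0 k else 0)"
      unfolding hess.simps using Suc.prems by (intro sum.cong refl) (auto simp: m)
    then show ?case using Suc by (simp add: monom_Suc)
  qed simp
  have "DN_char_poly n (cyclic_mat n) = (\<Sum>i\<le>n. (if i = n then monom 1 (Suc n) else 0) + (if i = 0 then - 1 else 0))"
    unfolding DN_char_poly_def hess.simps
  proof (intro sum.cong refl)
    fix i assume "i \<in> {..n}"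
    then show "?m (0 + i) (0 + n) * hess ?m 0 i =
        (if i = n then monom 1 (Suc n) else 0) + (if i = 0 then - 1 else 0)"
      using n by (auto simp: m low monom_Suc)
  qed
  also have "\<dots> = monom 1 (Suc n) - 1" by (simp add: sum.distrib)
  finally show ?thesis .
qed

theorem theorem6p10:
  fixes n :: nat
  assumes "n \<ge> 1"
  shows "\<exists>U. DN_zariski_open n U \<and> U \<noteq> {} \<and> (\<forall>A\<in>U. op_irreducible (DN_op n A))"
proof (intro exI conjI ballI)
  define D where "D A = resultant (DN_char_poly n A) (pderiv (DN_char_poly n A))" for A
  let ?U = "{A \<in> DN_params n. D A \<noteq> 0}"
  have nz: "DN_char_poly n A \<noteq> 0" for A
    using degree_hess_char_entry[of A "Suc n"] by (auto simp: DN_char_poly_def simp del: hess.simps)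
  have "D \<in> DN_poly_funs n" unfolding D_def by (rule resultant_poly_fun)
  then have "DN_zariski_closed n (DN_params n - ?U)"
    unfolding DN_zariski_closed_def by (intro exI[of _ "{D}"]) auto
  then show "DN_zariski_open n ?U" by (auto simp: DN_zariski_open_def)
  have "D (cyclic_mat n) \<noteq> 0"
    unfolding D_def resultant_pderiv_nonzero_iff[OF nz]
    unfolding char_poly_cyclic_mat[OF assms]
    by (auto simp: pderiv_diff pderiv_monom poly_monom simp del: power_Suc of_nat_Suc)
  then show "?U \<noteq> {}" using cyclic_mat_DN_params[OF assms] by auto
  fix A assume "A \<in> ?U"
  then show "op_irreducible (DN_op n A)"
    using assms resultant_pderiv_nonzero_iff[OF nz, of A] by (intro DN_op_irreducible) (auto simp: D_def)
qed

end
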